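(* Consider the critical levels $x_1$ and $x_2$ of the optimal stopping problem $V(x)=\sup_{\tau\ge0}E_x[e^{-r\tau}(\max\{l,X_\tau\}-K)^+]$ (defined in the context), as functions of the parameters $r$, $K$ and $l$, one parameter being varied at a time. Then $x_1$ is increasing and $x_2$ is decreasing with respect to $r$; $x_1$ is decreasing and $x_2$ is increasing with respect to $K$; both $x_1$ and $x_2$ are increasing with respect to $l$. (Monotonicity is in the weak sense; statements about $x_2$ concern parameter values for which $x_2$ is defined.)
   Context: Let $\mathcal I=(0,+\infty)$ and let $r>0$ be a constant. On a complete probability space with filtration $(\mathcal F_t)_{t\ge0}$ and an adapted standard one-dimensional Brownian motion $B$, the process $X$ with state space $\mathcal I$ satisfies $dX_t=\mu(X_t)dt+\sigma(X_t)dB_t$, $X_0=x\in\mathcal I$; $E_x=E[\cdot\mid X_0=x]$. Standing assumptions (for all parameter values considered): (i) $\mu:\mathcal I\to\mathbb R$ and $\sigma:\mathcal I\to(0,+\infty)$ are measurable and the SDE has a unique strong solution; (ii) $\theta(x)=rx-\mu(x)$ is non-decreasing on $\mathcal I$; (iii) $X$ is regular in $\mathcal I$ (every point of $\mathcal I$ is reached from every other with positive probability) and $0$ is a natural boundary. Let $\mathcal L=\frac12\sigma^2(x)\frac{d^2}{dx^2}+\mu(x)\frac{d}{dx}$. $\psi$ (resp. $\varphi$) denotes the positive strictly increasing (resp. strictly decreasing) $C^2$ solution, determined up to a positive factor, of $(\mathcal L-r)u=0$ on $\mathcal I$ such that, with $\tau_\kappa=\inf\{t\ge0:X_t=\kappa\}$,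 $E_x[e^{-r\tau_\kappa}]=\psi(x)/\psi(\kappa)$ for $x\le\kappa$ and $E_x[e^{-r\tau_\kappa}]=\varphi(x)/\varphi(\kappa)$ for $x\ge\kappa$. In this setting $\psi(0+)=0$, $\varphi(0+)=+\infty$, $\varphi(+\infty)=0$, and $F=\psi/\varphi$ is a strictly increasing bijection of $\mathcal I$ onto $(0,+\infty)$. It is further assumed that $\psi$ is convex on $(0,+\infty)$. Let $l>K>0$ be constants, $s=l-K$, $g(x)=s+(x-l)^+=(\max\{l,x\}-K)^+$, so $V(x)=\sup_{\tau\ge0}E_x[e^{-r\tau}g(X_\tau)]$. Suprema are over $(\mathcal F_t)$-stopping times $\tau$, and the payoff is $0$ on $\{\tau=+\infty\}$. Define $G(0)=0$ and $G(y)=(g/\varphi)(F^{-1}(y))$ for $y>0$. Set $L_{+\infty}=\lim_{x\to+\infty}g(x)/\psi(x)$, which is finite. $G$ is strictly concave on $(0,F(l))$, and $x_g\in[l,+\infty]$ is the unique point such that $G$ is convex on $(F(l),F(x_g))$ and strictly concave on $(F(x_g),+\infty)$ (if $x_g=l$ the first interval is empty; if $x_g=+\infty$ the first interval is $(F(l),+\infty)$ and the second is empty). For $z\in(0,F(l))$ let $L_z(y)=G(z)+G'(z)(y-z)$. If $L_{+\infty}>G'(F(l)^-)$, let $z_{L_{+\infty}}$ be the unique solution of $G'(z)=L_{+\infty}$ in $(0,F(l))$. The cases are: (A1) $L_{+\infty}\le G'(F(l)^-)$; (A2) $L_{+\infty}>G'(F(l)^-)$ and $\lim_{y\to+\infty}(G(y)-L_{z_{L_{+\infty}}}(y))>0$;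 (A3) $L_{+\infty}>G'(F(l)^-)$ and $\lim_{y\to+\infty}(G(y)-L_{z_{L_{+\infty}}}(y))\le0$. Critical levels: in cases (A1) and (A2), $(x_1,x_2)$ is the unique pair with $x_1<l\le x_g<x_2$ and $G'(F(x_1))=\frac{G(F(x_2))-G(F(x_1))}{F(x_2)-F(x_1)}=G'(F(x_2))$; the stopping region $\{V=g\}$ is then $(0,x_1]\cup[x_2,+\infty)$. In case (A3), only $x_1\in(0,l)$ is defined, as the solution of $(g/\varphi)'(x_1)=L_{+\infty}F'(x_1)$; the stopping region is then $(0,x_1]$. *)

theory Defs
  imports "HOL-Probability.Probability"
begin

text \<open>
  Processes are indexed by real times, only times \<open>t \<ge> 0\<close> being relevant. Filtrations and stopping
  times use the index set \<open>[0, \<infinity>]\<close> (type \<^typ>\<open>ennreal\<close>), so that \<^const>\<open>filtration\<close> and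
  \<^const>\<open>stopping_time\<close> apply to stopping times that may be infinite; at \<open>t = \<infinity>\<close> the condition
  defining a stopping time is trivial.
\<close>

definition brownian_motion ::
  "'a measure \<Rightarrow> (ennreal \<Rightarrow> 'a measure) \<Rightarrow> (real \<Rightarrow> 'a \<Rightarrow> real) \<Rightarrow> bool" where
  "brownian_motion M \<F> B \<longleftrightarrow>
     (\<forall>t\<ge>0. B t \<in> borel_measurable (\<F> (ennreal t))) \<and>
     (\<forall>\<omega>\<in>space M. continuous_on {0..} (\<lambda>t. B t \<omega>)) \<and>
     (AE \<omega> in M. B 0 \<omega> = 0) \<and>
     (\<forall>s t. 0 \<le> s \<and> s < t \<longrightarrow>
        distributed M lborel (\<lambda>\<omega>. B t \<omega> - B s \<omega>) (normal_density 0 (sqrt (t - s))) \<and>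
        prob_space.indep_set M (sets (\<F> (ennreal s)))
          (sets (vimage_algebra (space M) (\<lambda>\<omega>. B t \<omega> - B s \<omega>) borel)))"

text \<open>
  The step process \<open>\<Sum>i<n. \<xi> i 1\<^bsub>(T i, T (i+1)]\<^esub>\<close> with bounded \<open>\<xi> i\<close> known at time \<open>T i\<close>, and its
  stochastic integral.
\<close>

definition step_data ::
  "'a measure \<Rightarrow> (ennreal \<Rightarrow> 'a measure) \<Rightarrow> nat \<Rightarrow> (nat \<Rightarrow> real) \<Rightarrow> (nat \<Rightarrow> 'a \<Rightarrow> real) \<Rightarrow> bool" where
  "step_data M \<F> n T \<xi> \<longleftrightarrow>
     0 \<le> T 0 \<and> (\<forall>i<n. T i \<le> T (Suc i)) \<and>
     (\<forall>i<n. \<xi> i \<in> borel_measurable (\<F> (ennreal (T i))) \<and> (\<exists>C. \<forall>\<omega>\<in>space M. \<bar>\<xi> i \<omega>\<bar> \<le> C))"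

definition step_process ::
  "nat \<Rightarrow> (nat \<Rightarrow> real) \<Rightarrow> (nat \<Rightarrow> 'a \<Rightarrow> real) \<Rightarrow> real \<Rightarrow> 'a \<Rightarrow> real" where
  "step_process n T \<xi> t \<omega> = (\<Sum>i<n. \<xi> i \<omega> * indicator {T i<..T (Suc i)} t)"

definition step_integral ::
  "(real \<Rightarrow> 'a \<Rightarrow> real) \<Rightarrow> nat \<Rightarrow> (nat \<Rightarrow> real) \<Rightarrow> (nat \<Rightarrow> 'a \<Rightarrow> real) \<Rightarrow> real \<Rightarrow> 'a \<Rightarrow> real" where
  "step_integral B n T \<xi> t \<omega> =
     (\<Sum>i<n. \<xi> i \<omega> * (B (min t (T (Suc i))) \<omega> - B (min t (T i)) \<omega>))"

text \<open>
  \<open>I\<close> is (a version of) the stochastic integral \<open>\<integral> H dB\<close> of a progressively measurable \<open>H\<close> with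
  locally square integrable paths: the limit of the integrals of step processes approximating \<open>H\<close>.
  The usual definition asks for both limits in probability; passing to subsequences, an
  approximating sequence can always be chosen to converge almost surely, which characterises the
  same \<open>I\<close>.
\<close>

definition ito_integral ::
  "'a measure \<Rightarrow> (ennreal \<Rightarrow> 'a measure) \<Rightarrow> (real \<Rightarrow> 'a \<Rightarrow> real) \<Rightarrow> (real \<Rightarrow> 'a \<Rightarrow> real) \<Rightarrow>
   (real \<Rightarrow> 'a \<Rightarrow> real) \<Rightarrow> bool" where
  "ito_integral M \<F> B H I \<longleftrightarrow>
     (\<exists>n T \<xi>. (\<forall>k. step_data M \<F> (n k) (T k) (\<xi> k)) \<and>
       (\<forall>t\<ge>0. AE \<omega> in M.
          (\<lambda>k. \<integral>\<^sup>+ s. ennreal ((step_process (n k) (T k) (\<xi> k) s \<omega> - H s \<omega>)\<^sup>2)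
                  * indicator {0..t} s \<partial>lborel) \<longlonglongrightarrow> 0 \<and>
          uniform_limit {0..t} (\<lambda>k s. step_integral B (n k) (T k) (\<xi> k) s \<omega>) (\<lambda>s. I s \<omega>)
            sequentially))"

definition sde_solution ::
  "'a measure \<Rightarrow> (ennreal \<Rightarrow> 'a measure) \<Rightarrow> (real \<Rightarrow> 'a \<Rightarrow> real) \<Rightarrow> (real \<Rightarrow> real) \<Rightarrow> (real \<Rightarrow> real) \<Rightarrow>
   real \<Rightarrow> (real \<Rightarrow> 'a \<Rightarrow> real) \<Rightarrow> bool" where
  "sde_solution M \<F> B \<mu> \<sigma> x X \<longleftrightarrow>
     (\<forall>t\<ge>0. X t \<in> borel_measurable (\<F> (ennreal t))) \<and>
     (\<forall>\<omega>\<in>space M. continuous_on {0..} (\<lambda>t. X t \<omega>) \<and> (\<forall>t\<ge>0. 0 < X t \<omega>)) \<and>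
     (AE \<omega> in M. X 0 \<omega> = x) \<and>
     (\<forall>t\<ge>0. AE \<omega> in M. set_integrable lborel {0..t} (\<lambda>s. \<mu> (X s \<omega>)) \<and>
                        set_integrable lborel {0..t} (\<lambda>s. (\<sigma> (X s \<omega>))\<^sup>2)) \<and>
     ito_integral M \<F> B (\<lambda>t \<omega>. \<sigma> (X t \<omega>))
       (\<lambda>t \<omega>. X t \<omega> - x - (LINT s:{0..t}|lborel. \<mu> (X s \<omega>)))"

definition augmented_brownian_filtration ::
  "'a measure \<Rightarrow> (real \<Rightarrow> 'a \<Rightarrow> real) \<Rightarrow> ennreal \<Rightarrow> 'a measure" where
  "augmented_brownian_filtration M B t =
     sigma (space M)
       ({B s -` A \<inter> space M | s A. 0 \<le> s \<and> ennreal s \<le> t \<and> A \<in> sets borel} \<union> null_sets M)"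

definition strong_solution ::
  "'a measure \<Rightarrow> (ennreal \<Rightarrow> 'a measure) \<Rightarrow> (real \<Rightarrow> 'a \<Rightarrow> real) \<Rightarrow> (real \<Rightarrow> real) \<Rightarrow> (real \<Rightarrow> real) \<Rightarrow>
   real \<Rightarrow> (real \<Rightarrow> 'a \<Rightarrow> real) \<Rightarrow> bool" where
  "strong_solution M \<F> B \<mu> \<sigma> x X \<longleftrightarrow>
     sde_solution M \<F> B \<mu> \<sigma> x X \<and>
     (\<forall>t\<ge>0. X t \<in> borel_measurable (augmented_brownian_filtration M B (ennreal t)))"

definition hitting_time :: "(real \<Rightarrow> 'a \<Rightarrow> real) \<Rightarrow> real \<Rightarrow> 'a \<Rightarrow> ennreal" where
  "hitting_time X \<kappa> \<omega> = Inf {ennreal t | t. 0 \<le> t \<and> X t \<omega> = \<kappa>}"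

definition regular_diffusion :: "'a measure \<Rightarrow> (real \<Rightarrow> real \<Rightarrow> 'a \<Rightarrow> real) \<Rightarrow> bool" where
  "regular_diffusion M X \<longleftrightarrow>
     (\<forall>x>0. \<forall>y>0. 0 < measure M {\<omega> \<in> space M. hitting_time (X x) y \<omega> < \<infinity>})"

text \<open>
  In Feller's classification a natural boundary is one that is neither accessible nor an entrance.
  Inaccessibility of \<open>0\<close> is built into \<^const>\<open>sde_solution\<close>, whose paths stay in \<open>(0, \<infinity>)\<close>; what
  remains is that the diffusion cannot be started at \<open>0\<close>.
\<close>

definition not_entrance_at_zero :: "'a measure \<Rightarrow> (real \<Rightarrow> real \<Rightarrow> 'a \<Rightarrow> real) \<Rightarrow> bool" where
  "not_entrance_at_zero M X \<longleftrightarrow>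
     (\<forall>y>0. \<forall>t\<ge>0.
        ((\<lambda>x. measure M {\<omega> \<in> space M. hitting_time (X x) y \<omega> \<le> ennreal t}) \<longlongrightarrow> 0) (at_right 0))"

text \<open>\<open>X x\<close> is the process started at \<open>x\<close>, so that \<open>E\<^sub>x[f(X)]\<close> is the expectation of \<open>f (X x)\<close>.\<close>

locale diffusion_setting = prob_space M + complete_measure M + filtration "space M" \<F>
  for M :: "'a measure" and \<F> :: "ennreal \<Rightarrow> 'a measure" +
  fixes B :: "real \<Rightarrow> 'a \<Rightarrow> real"
    and \<mu> \<sigma> :: "real \<Rightarrow> real"
    and X :: "real \<Rightarrow> real \<Rightarrow> 'a \<Rightarrow> real"
  assumes subalgebra_F: "\<And>t. subalgebra M (\<F> t)"
    and brownian: "brownian_motion M \<F> B"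
    and mu_measurable: "\<mu> \<in> borel_measurable (restrict_space borel {0<..})"
    and sigma_measurable: "\<sigma> \<in> borel_measurable (restrict_space borel {0<..})"
    and sigma_pos: "\<And>x. 0 < x \<Longrightarrow> 0 < \<sigma> x"
    and solution: "\<And>x. 0 < x \<Longrightarrow> strong_solution M \<F> B \<mu> \<sigma> x (X x)"
    and solution_unique: "\<And>x Y. 0 < x \<Longrightarrow> strong_solution M \<F> B \<mu> \<sigma> x Y \<Longrightarrow>
                            AE \<omega> in M. \<forall>t\<ge>0. Y t \<omega> = X x t \<omega>"
    and regular: "regular_diffusion M X"
    and natural_boundary: "not_entrance_at_zero M X"

text \<open>\<open>e\<^bsup>-r\<tau>\<^esup>\<close>, which vanishes for \<open>\<tau> = \<infinity>\<close>.\<close>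

definition discount :: "real \<Rightarrow> ennreal \<Rightarrow> real" where
  "discount r \<tau> = (if \<tau> = \<infinity> then 0 else exp (- r * enn2real \<tau>))"

definition C2_on_pos :: "(real \<Rightarrow> real) \<Rightarrow> bool" where
  "C2_on_pos u \<longleftrightarrow>
     (\<forall>x>0. u field_differentiable at x \<and> deriv u field_differentiable at x) \<and>
     continuous_on {0<..} (deriv (deriv u))"

definition generator :: "(real \<Rightarrow> real) \<Rightarrow> (real \<Rightarrow> real) \<Rightarrow> (real \<Rightarrow> real) \<Rightarrow> real \<Rightarrow> real" where
  "generator \<mu> \<sigma> u x = 1/2 * (\<sigma> x)\<^sup>2 * deriv (deriv u) x + \<mu> x * deriv u x"

definition positive_r_harmonic ::
  "(real \<Rightarrow> real) \<Rightarrow> (real \<Rightarrow> real) \<Rightarrow> real \<Rightarrow> (real \<Rightarrow> real) \<Rightarrow> bool" where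
  "positive_r_harmonic \<mu> \<sigma> r u \<longleftrightarrow>
     C2_on_pos u \<and> (\<forall>x>0. 0 < u x) \<and> (\<forall>x>0. generator \<mu> \<sigma> u x - r * u x = 0)"

text \<open>
  The assumptions that involve the discount rate. Of the boundary behaviour of \<open>\<psi>\<close> and \<open>\<phi>\<close>,
  only \<open>\<phi>(+\<infinity>) = 0\<close> is listed: nothing else is assumed about the boundary \<open>+\<infinity>\<close>, whereas
  \<open>\<psi>(0+) = 0\<close> and \<open>\<phi>(0+) = +\<infinity>\<close> express that \<open>0\<close> is a natural boundary, and the divergence of
  \<open>\<psi>\<close> at \<open>+\<infinity>\<close> comes from convexity.
\<close>

locale discount_setting =
  fixes M :: "'a measure" and \<mu> \<sigma> :: "real \<Rightarrow> real" and X :: "real \<Rightarrow> real \<Rightarrow> 'a \<Rightarrow> real"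
    and r :: real and \<psi> \<phi> :: "real \<Rightarrow> real"
  assumes r_pos: "0 < r"
    and theta_mono: "mono_on {0<..} (\<lambda>x. r * x - \<mu> x)"
    and psi_harmonic: "positive_r_harmonic \<mu> \<sigma> r \<psi>"
    and psi_increasing: "strict_mono_on {0<..} \<psi>"
    and psi_hitting: "\<And>x \<kappa>. 0 < x \<Longrightarrow> x \<le> \<kappa> \<Longrightarrow>
          (\<integral>\<omega>. discount r (hitting_time (X x) \<kappa> \<omega>) \<partial>M) = \<psi> x / \<psi> \<kappa>"
    and phi_harmonic: "positive_r_harmonic \<mu> \<sigma> r \<phi>"
    and phi_decreasing: "strict_antimono_on {0<..} \<phi>"
    and phi_hitting: "\<And>x \<kappa>. 0 < \<kappa> \<Longrightarrow> \<kappa> \<le> x \<Longrightarrow>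
          (\<integral>\<omega>. discount r (hitting_time (X x) \<kappa> \<omega>) \<partial>M) = \<phi> x / \<phi> \<kappa>"
    and phi_at_top: "(\<phi> \<longlongrightarrow> 0) at_top"
    and psi_convex: "convex_on {0<..} \<psi>"

definition payoff :: "real \<Rightarrow> real \<Rightarrow> real \<Rightarrow> real" where
  "payoff K l x = max (max l x - K) 0"

definition value_function ::
  "'a measure \<Rightarrow> (ennreal \<Rightarrow> 'a measure) \<Rightarrow> (real \<Rightarrow> real \<Rightarrow> 'a \<Rightarrow> real) \<Rightarrow>
   real \<Rightarrow> real \<Rightarrow> real \<Rightarrow> real \<Rightarrow> ennreal" where
  "value_function M \<F> X r K l x =
     (SUP \<tau> \<in> {\<tau>. stopping_time \<F> \<tau>}.
        \<integral>\<^sup>+ \<omega>. ennreal (discount r (\<tau> \<omega>) * payoff K l (X x (enn2real (\<tau> \<omega>)) \<omega>)) \<partial>M)"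

definition stopping_region ::
  "'a measure \<Rightarrow> (ennreal \<Rightarrow> 'a measure) \<Rightarrow> (real \<Rightarrow> real \<Rightarrow> 'a \<Rightarrow> real) \<Rightarrow>
   real \<Rightarrow> real \<Rightarrow> real \<Rightarrow> real set" where
  "stopping_region M \<F> X r K l = {x. 0 < x \<and> value_function M \<F> X r K l x = ennreal (payoff K l x)}"

text \<open>The functions \<open>F = \<psi>/\<phi>\<close> and \<open>G = (g/\<phi>) \<circ> F\<^sup>-\<^sup>1\<close>, the latter extended by \<open>G(0) = 0\<close>.\<close>

definition F_fun :: "(real \<Rightarrow> real) \<Rightarrow> (real \<Rightarrow> real) \<Rightarrow> real \<Rightarrow> real" where
  "F_fun \<psi> \<phi> x = \<psi> x / \<phi> x"

definition G_fun :: "(real \<Rightarrow> real) \<Rightarrow> (real \<Rightarrow> real) \<Rightarrow> real \<Rightarrow> real \<Rightarrow> real \<Rightarrow> real" where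
  "G_fun \<psi> \<phi> K l y =
     (if y = 0 then 0
      else let x = the_inv_into {0<..} (F_fun \<psi> \<phi>) y in payoff K l x / \<phi> x)"

definition L_infinity :: "(real \<Rightarrow> real) \<Rightarrow> real \<Rightarrow> real \<Rightarrow> real" where
  "L_infinity \<psi> K l = Lim at_top (\<lambda>x. payoff K l x / \<psi> x)"

definition strictly_concave_on :: "real set \<Rightarrow> (real \<Rightarrow> real) \<Rightarrow> bool" where
  "strictly_concave_on S f \<longleftrightarrow> convex S \<and>
     (\<forall>x\<in>S. \<forall>y\<in>S. \<forall>u>0. \<forall>v>0. x \<noteq> y \<and> u + v = 1 \<longrightarrow> u * f x + v * f y < f (u * x + v * y))"

text \<open>
  The images under \<open>F\<close> are the intervals \<open>(F(l), F(x\<^sub>g))\<close> and \<open>(F(x\<^sub>g), +\<infinity>)\<close>, also when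
  \<open>x\<^sub>g = l\<close> or \<open>x\<^sub>g = +\<infinity>\<close>. There is at most one such \<open>x\<^sub>g\<close>.
\<close>

definition is_x_g :: "(real \<Rightarrow> real) \<Rightarrow> (real \<Rightarrow> real) \<Rightarrow> real \<Rightarrow> real \<Rightarrow> ereal \<Rightarrow> bool" where
  "is_x_g \<psi> \<phi> K l xg \<longleftrightarrow>
     ereal l \<le> xg \<and>
     convex_on (F_fun \<psi> \<phi> ` {x. l < x \<and> ereal x < xg}) (G_fun \<psi> \<phi> K l) \<and>
     strictly_concave_on (F_fun \<psi> \<phi> ` {x. xg < ereal x}) (G_fun \<psi> \<phi> K l)"

definition G_left_slope :: "(real \<Rightarrow> real) \<Rightarrow> (real \<Rightarrow> real) \<Rightarrow> real \<Rightarrow> real \<Rightarrow> real" where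
  "G_left_slope \<psi> \<phi> K l = Lim (at_left (F_fun \<psi> \<phi> l)) (deriv (G_fun \<psi> \<phi> K l))"

definition tangent_line ::
  "(real \<Rightarrow> real) \<Rightarrow> (real \<Rightarrow> real) \<Rightarrow> real \<Rightarrow> real \<Rightarrow> real \<Rightarrow> real \<Rightarrow> real" where
  "tangent_line \<psi> \<phi> K l z y = G_fun \<psi> \<phi> K l z + deriv (G_fun \<psi> \<phi> K l) z * (y - z)"

definition z_infinity :: "(real \<Rightarrow> real) \<Rightarrow> (real \<Rightarrow> real) \<Rightarrow> real \<Rightarrow> real \<Rightarrow> real" where
  "z_infinity \<psi> \<phi> K l =
     (THE z. 0 < z \<and> z < F_fun \<psi> \<phi> l \<and> deriv (G_fun \<psi> \<phi> K l) z = L_infinity \<psi> K l)"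

definition asymptotic_gap :: "(real \<Rightarrow> real) \<Rightarrow> (real \<Rightarrow> real) \<Rightarrow> real \<Rightarrow> real \<Rightarrow> ereal" where
  "asymptotic_gap \<psi> \<phi> K l =
     Lim at_top (\<lambda>y. ereal (G_fun \<psi> \<phi> K l y - tangent_line \<psi> \<phi> K l (z_infinity \<psi> \<phi> K l) y))"

definition case_A1 :: "(real \<Rightarrow> real) \<Rightarrow> (real \<Rightarrow> real) \<Rightarrow> real \<Rightarrow> real \<Rightarrow> bool" where
  "case_A1 \<psi> \<phi> K l \<longleftrightarrow> L_infinity \<psi> K l \<le> G_left_slope \<psi> \<phi> K l"

definition case_A2 :: "(real \<Rightarrow> real) \<Rightarrow> (real \<Rightarrow> real) \<Rightarrow> real \<Rightarrow> real \<Rightarrow> bool" where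
  "case_A2 \<psi> \<phi> K l \<longleftrightarrow> L_infinity \<psi> K l > G_left_slope \<psi> \<phi> K l \<and> asymptotic_gap \<psi> \<phi> K l > 0"

definition case_A3 :: "(real \<Rightarrow> real) \<Rightarrow> (real \<Rightarrow> real) \<Rightarrow> real \<Rightarrow> real \<Rightarrow> bool" where
  "case_A3 \<psi> \<phi> K l \<longleftrightarrow> L_infinity \<psi> K l > G_left_slope \<psi> \<phi> K l \<and> asymptotic_gap \<psi> \<phi> K l \<le> 0"

definition double_tangency ::
  "(real \<Rightarrow> real) \<Rightarrow> (real \<Rightarrow> real) \<Rightarrow> real \<Rightarrow> real \<Rightarrow> real \<Rightarrow> real \<Rightarrow> bool" where
  "double_tangency \<psi> \<phi> K l x1 x2 \<longleftrightarrow>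
     (let F = F_fun \<psi> \<phi>; G = G_fun \<psi> \<phi> K l; c = (G (F x2) - G (F x1)) / (F x2 - F x1) in
        0 < x1 \<and> x1 < l \<and> (\<exists>xg. is_x_g \<psi> \<phi> K l xg \<and> xg < ereal x2) \<and>
        deriv G (F x1) = c \<and> c = deriv G (F x2))"

text \<open>
  The critical levels: \<open>critical_x1 \<psi> \<phi> K l x\<close> says that \<open>x\<close> is the level \<open>x\<^sub>1\<close>, and
  \<open>critical_x2 \<psi> \<phi> K l x\<close> that \<open>x\<^sub>2\<close> is defined and equal to \<open>x\<close>.
\<close>

definition critical_x1 :: "(real \<Rightarrow> real) \<Rightarrow> (real \<Rightarrow> real) \<Rightarrow> real \<Rightarrow> real \<Rightarrow> real \<Rightarrow> bool" where
  "critical_x1 \<psi> \<phi> K l x1 \<longleftrightarrow>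
     (case_A1 \<psi> \<phi> K l \<or> case_A2 \<psi> \<phi> K l) \<and> (\<exists>x2. double_tangency \<psi> \<phi> K l x1 x2) \<or>
     case_A3 \<psi> \<phi> K l \<and> 0 < x1 \<and> x1 < l \<and>
       deriv (\<lambda>x. payoff K l x / \<phi> x) x1 = L_infinity \<psi> K l * deriv (F_fun \<psi> \<phi>) x1"

definition critical_x2 :: "(real \<Rightarrow> real) \<Rightarrow> (real \<Rightarrow> real) \<Rightarrow> real \<Rightarrow> real \<Rightarrow> real \<Rightarrow> bool" where
  "critical_x2 \<psi> \<phi> K l x2 \<longleftrightarrow>
     (case_A1 \<psi> \<phi> K l \<or> case_A2 \<psi> \<phi> K l) \<and> (\<exists>x1. double_tangency \<psi> \<phi> K l x1 x2)"

text \<open>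
  The same levels read off from the stopping region \<open>{V = g}\<close>, which is
  \<open>(0, x\<^sub>1] \<union> [x\<^sub>2, +\<infinity>)\<close> or, when \<open>x\<^sub>2\<close> is undefined, \<open>(0, x\<^sub>1]\<close>. That both descriptions agree is
  not assumed anywhere.
\<close>

definition region_x1 ::
  "'a measure \<Rightarrow> (ennreal \<Rightarrow> 'a measure) \<Rightarrow> (real \<Rightarrow> real \<Rightarrow> 'a \<Rightarrow> real) \<Rightarrow>
   real \<Rightarrow> real \<Rightarrow> real \<Rightarrow> real \<Rightarrow> bool" where
  "region_x1 M \<F> X r K l x1 \<longleftrightarrow> 0 < x1 \<and> x1 < l \<and>
     (stopping_region M \<F> X r K l = {0<..x1} \<or>
      (\<exists>x2>l. stopping_region M \<F> X r K l = {0<..x1} \<union> {x2..}))"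

definition region_x2 ::
  "'a measure \<Rightarrow> (ennreal \<Rightarrow> 'a measure) \<Rightarrow> (real \<Rightarrow> real \<Rightarrow> 'a \<Rightarrow> real) \<Rightarrow>
   real \<Rightarrow> real \<Rightarrow> real \<Rightarrow> real \<Rightarrow> bool" where
  "region_x2 M \<F> X r K l x2 \<longleftrightarrow> l < x2 \<and>
     (\<exists>x1. 0 < x1 \<and> x1 < l \<and> stopping_region M \<F> X r K l = {0<..x1} \<union> {x2..})"

end

theory Submission
  imports Defs
begin

text \<open>
  Both descriptions of the levels present \<open>x\<^sub>1\<close> and \<open>x\<^sub>2\<close> as the ends of a gap around \<open>l\<close> in a set
  \<open>S(r, K, l)\<close> on which stopping is optimal, and the monotonicity only uses two properties of this
  set. It grows with \<open>r\<close>, because heavier discounting lowers the value but not the payoff. And if a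
  change of \<open>K\<close> and \<open>l\<close> raises the payoff by at most \<open>\<delta> \<ge> 0\<close> everywhere and by exactly \<open>\<delta>\<close> at a
  point \<open>x\<close> of the set, then \<open>x\<close> remains in the set, because the value rises by at most \<open>\<delta>\<close>. Since
  \<open>g(x) = max l x - K\<close>, lowering \<open>K\<close> is such a change at every \<open>x\<close>, raising \<open>l\<close> to \<open>l'\<close> is one for
  \<open>x \<le> l\<close> with \<open>\<delta> = l' - l\<close>, and lowering \<open>l'\<close> to \<open>l\<close> is one for \<open>x \<ge> l'\<close> with \<open>\<delta> = 0\<close>
  (\<open>levels_monotone\<close>).

  For the stopping region \<open>{V = g}\<close> the two properties are inequalities between suprema of
  expectations. For the levels defined by tangency, \<open>S\<close> is the contact set: the points at which some
  \<open>C\<^sup>1\<close> supersolution \<open>u\<close> of \<open>\<L> u - r u \<le> 0\<close> lying above \<open>g\<close> touches \<open>g\<close>. Now both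
  properties are immediate, as a nonnegative supersolution remains one when \<open>r\<close> grows or a
  nonnegative constant is added; the work lies in showing that the critical levels bound a gap in
  the contact set.

  A line \<open>a + b y\<close> in the coordinate \<open>y = F(x)\<close> is the harmonic function \<open>h = a \<phi> + b \<psi>\<close>, and
  tangency of the line to \<open>G\<close> is smooth fit of \<open>h\<close> to \<open>g\<close>. The function equal to \<open>s\<close> below \<open>x\<^sub>1\<close>,
  to \<open>h\<close> on \<open>[x\<^sub>1, x\<^sub>2]\<close> and to \<open>x - K\<close> above \<open>x\<^sub>2\<close> is a supersolution above \<open>g\<close> that touches \<open>g\<close>
  at both levels. Conversely, the maximum principle (\<open>harmonic_le_supersolution\<close>) puts \<open>h\<close> below
  every supersolution above \<open>g\<close> on \<open>[x\<^sub>1, x\<^sub>2]\<close>, and \<open>h > g\<close> inside, so there is no contact between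
  the levels (\<open>double_tangency_levels\<close>). In case (A3) the same works with \<open>x\<^sub>2 = +\<infinity>\<close> and
  \<open>b = L\<^sub>\<infinity>\<close> (\<open>infinite_tangency_level\<close>): there \<open>h \<ge> g\<close> far out follows from the sign of the
  asymptotic gap, and minimality of \<open>h\<close> from comparing \<open>h - \<epsilon> \<psi>\<close>, which falls below \<open>g\<close> far out.
\<close>

section \<open>Convexity, monotone limits and one-sided derivatives\<close>

text \<open>
  One-sided in the second derivative, because the supersolutions below are glued from pieces and
  have no second derivative at the joints.
\<close>

lemma second_derivative_nonneg_at_right_min:
  fixes f d :: "real \<Rightarrow> real"
  assumes "p < q"
    and f: "\<And>x. p \<le> x \<Longrightarrow> x < q \<Longrightarrow> (f has_real_derivative d x) (at x)"
    and d: "d p = 0" "(d has_real_derivative c) (at p within {p..})"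
    and min: "\<And>x. p \<le> x \<Longrightarrow> x < q \<Longrightarrow> f p \<le> f x"
  shows "0 \<le> c"
proof (rule ccontr)
  assume "\<not> 0 \<le> c"
  then obtain e where e: "0 < e" "\<And>h. 0 < h \<Longrightarrow> p + h \<in> {p..} \<Longrightarrow> h < e \<Longrightarrow> d (p + h) < d p"
    using has_real_derivative_neg_dec_right[OF d(2)] by force
  define t where "t = min e (q - p) / 2"
  have t: "0 < t" "t < e" "p + t < q"
    using \<open>p < q\<close> e(1) by (auto simp: t_def min_def field_simps)
  have "\<And>x. p \<le> x \<Longrightarrow> x \<le> p + t \<Longrightarrow> (f has_real_derivative d x) (at x)"
    using f t by auto
  then obtain z where z: "p < z" "z < p + t" "f (p + t) - f p = (p + t - p) * d z"
    using MVT2[of p "p + t" f d] t by auto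
  have "d z < 0"
    using e(2)[of "z - p"] z t d(1) by auto
  then have "f (p + t) < f p"
    using z(3) mult_pos_neg[OF t(1), of "d z"] by simp
  then show False
    using min[of "p + t"] t by auto
qed

lemma has_real_derivative_glue:
  fixes f g :: "real \<Rightarrow> real"
  assumes f: "(f has_real_derivative D) (at p)" and g: "(g has_real_derivative D) (at p)"
    and "f p = g p"
  shows "((\<lambda>x. if x < p then f x else g x) has_real_derivative D) (at p)"
proof -
  let ?h = "\<lambda>x. if x < p then f x else g x"
  have "((\<lambda>x. (f x - f p) / (x - p)) \<longlongrightarrow> D) (at_left p)"
    using has_field_derivative_at_within[OF f, of "{..<p}"] by (simp add: has_field_derivative_iff)
  moreover have "\<forall>\<^sub>F x in at_left p. (f x - f p) / (x - p) = (?h x - ?h p) / (x - p)"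
    using \<open>f p = g p\<close> by (auto simp: eventually_at_filter)
  ultimately have left: "((\<lambda>x. (?h x - ?h p) / (x - p)) \<longlongrightarrow> D) (at_left p)"
    by (rule Lim_transform_eventually)
  have "((\<lambda>x. (g x - g p) / (x - p)) \<longlongrightarrow> D) (at_right p)"
    using has_field_derivative_at_within[OF g, of "{p<..}"] by (simp add: has_field_derivative_iff)
  moreover have "\<forall>\<^sub>F x in at_right p. (g x - g p) / (x - p) = (?h x - ?h p) / (x - p)"
    by (auto simp: eventually_at_filter)
  ultimately have "((\<lambda>x. (?h x - ?h p) / (x - p)) \<longlongrightarrow> D) (at_right p)"
    by (rule Lim_transform_eventually)
  with left show ?thesis
    unfolding has_field_derivative_iff by (rule filterlim_split_at)
qed

lemma tendsto_SUP_at_top: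
  fixes f :: "real \<Rightarrow> ereal"
  assumes "mono_on {a..} f"
  shows "(f \<longlongrightarrow> (SUP x\<in>{a..}. f x)) at_top"
proof (rule order_tendstoI)
  fix c assume "c < (SUP x\<in>{a..}. f x)"
  then obtain b where b: "a \<le> b" "c < f b"
    by (auto simp: less_SUP_iff)
  have "c < f x" if "b \<le> x" for x
    using b that mono_onD[OF assms, of b x] by auto
  then show "\<forall>\<^sub>F x in at_top. c < f x"
    unfolding eventually_at_top_linorder by blast
next
  fix c assume c: "(SUP x\<in>{a..}. f x) < c"
  have "f x < c" if "a \<le> x" for x
    using c that by (meson SUP_lessD atLeast_iff)
  then show "\<forall>\<^sub>F x in at_top. f x < c"
    unfolding eventually_at_top_linorder by blast
qed

lemma antimono_bounded_below_converges:
  fixes f :: "real \<Rightarrow> real"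
  assumes anti: "\<And>x y. a \<le> x \<Longrightarrow> x \<le> y \<Longrightarrow> f y \<le> f x" and nonneg: "\<And>x. a \<le> x \<Longrightarrow> 0 \<le> f x"
  shows "\<exists>L. (f \<longlongrightarrow> L) at_top"
proof -
  let ?S = "SUP x\<in>{a..}. ereal (- f x)"
  have lim: "((\<lambda>x. ereal (- f x)) \<longlongrightarrow> ?S) at_top"
    by (rule tendsto_SUP_at_top) (auto intro!: mono_onI anti)
  have "ereal (- f a) \<le> ?S" "?S \<le> ereal 0"
    by (auto intro!: SUP_upper SUP_least nonneg)
  then obtain m where "?S = ereal m"
    by (cases ?S) auto
  then have "((\<lambda>x. - f x) \<longlongrightarrow> m) at_top"
    using lim by (simp add: lim_ereal)
  then show ?thesis
    using tendsto_minus by fastforce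
qed

text \<open>
  Concavity gives the weak inequality at the midpoint of \<open>c\<close> and \<open>y\<close>; strict concavity between the
  midpoint and the end points makes it strict at \<open>y\<close>.
\<close>

lemma strictly_concave_below_tangent:
  fixes f :: "real \<Rightarrow> real"
  assumes f: "strictly_concave_on S f" and c: "c \<in> interior S" and f': "(f has_real_derivative f') (at c)"
    and y: "y \<in> S" "y \<noteq> c"
  shows "f y < f c + f' * (y - c)"
proof -
  have S: "convex S"
    using f by (simp add: strictly_concave_on_def)
  have cS: "c \<in> S"
    using c interior_subset by blast
  have strict: "u * f a + v * f b < f (u * a + v * b)"
    if "a \<in> S" "b \<in> S" "0 < u" "0 < v" "a \<noteq> b" "u + v = 1" for a b u v
    using f that unfolding strictly_concave_on_def by blast
  have "convex_on S (\<lambda>x. - f x)"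
  proof (rule convex_onI[OF _ S])
    fix t a b :: real assume t: "0 < t" "t < 1" and ab: "a \<in> S" "b \<in> S"
    show "- f ((1 - t) *\<^sub>R a + t *\<^sub>R b) \<le> (1 - t) * - f a + t * - f b"
    proof (cases "a = b")
      case True
      then show ?thesis by (simp add: algebra_simps)
    next
      case False
      then show ?thesis
        using strict[OF ab, of "1 - t" t] t by simp
    qed
  qed
  moreover have "((\<lambda>x. - f x) has_real_derivative - f') (at c within S)"
    by (rule DERIV_minus[OF has_field_derivative_at_within[OF f']])
  moreover have mid: "(c + y) / 2 \<in> S"
    using convexD_alt[OF S cS y(1), of "1/2"] by (simp add: field_simps)
  ultimately have "- f ((c + y) / 2) - - f c \<ge> - f' * ((c + y) / 2 - c)"
    using convex_on_imp_above_tangent[of S "\<lambda>x. - f x"] convex_connected[OF S] c by blast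
  moreover have "1/2 * f c + 1/2 * f y < f (1/2 * c + 1/2 * y)"
    using strict[OF cS y(1), of "1/2" "1/2"] y(2) by simp
  moreover have "1/2 * c + 1/2 * y = (c + y) / 2"
    by simp
  ultimately show ?thesis
    by (simp add: field_simps)
qed

section \<open>Supersolutions and the maximum principle\<close>

text \<open>
  \<open>\<L> u - r u \<le> 0\<close> for a \<open>C\<^sup>1\<close> function with a right second derivative: the regularity that smooth
  fit leaves at the joints, and enough for the maximum principle.
\<close>

definition supersolution_on ::
  "(real \<Rightarrow> real) \<Rightarrow> (real \<Rightarrow> real) \<Rightarrow> real \<Rightarrow> real set \<Rightarrow> (real \<Rightarrow> real) \<Rightarrow> bool" where
  "supersolution_on \<mu> \<sigma> r A u \<longleftrightarrow>
     (\<exists>d. \<forall>x\<in>A. (u has_real_derivative d x) (at x) \<and>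
        (\<exists>c. (d has_real_derivative c) (at x within {x..}) \<and>
             1/2 * (\<sigma> x)\<^sup>2 * c + \<mu> x * d x - r * u x \<le> 0))"

text \<open>
  At an interior negative minimum \<open>p\<close> of \<open>u - h\<close> the first derivatives agree and the right second
  derivative of \<open>u - h\<close> is nonnegative, so the differential relations give \<open>r h(p) \<le> r u(p)\<close>.
\<close>

lemma harmonic_le_supersolution:
  fixes h :: "real \<Rightarrow> real"
  assumes "0 < r"
    and u: "supersolution_on \<mu> \<sigma> r {\<alpha><..<\<beta>} u" "continuous_on {\<alpha>..\<beta>} u"
    and h: "continuous_on {\<alpha>..\<beta>} h"
      "\<And>x. \<alpha> < x \<Longrightarrow> x < \<beta> \<Longrightarrow> (h has_real_derivative h' x) (at x)"
      "\<And>x. \<alpha> < x \<Longrightarrow> x < \<beta> \<Longrightarrow> (h' has_real_derivative h'' x) (at x)"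
      "\<And>x. \<alpha> < x \<Longrightarrow> x < \<beta> \<Longrightarrow> 1/2 * (\<sigma> x)\<^sup>2 * h'' x + \<mu> x * h' x = r * h x"
    and boundary: "h \<alpha> \<le> u \<alpha>" "h \<beta> \<le> u \<beta>"
    and x: "\<alpha> \<le> x" "x \<le> \<beta>"
  shows "h x \<le> u x"
proof (rule ccontr)
  assume neg: "\<not> h x \<le> u x"
  have "continuous_on {\<alpha>..\<beta>} (\<lambda>x. u x - h x)"
    using u(2) h(1) by (intro continuous_intros)
  then obtain p where p: "p \<in> {\<alpha>..\<beta>}" "\<And>y. y \<in> {\<alpha>..\<beta>} \<Longrightarrow> u p - h p \<le> u y - h y"
    using continuous_attains_inf[of "{\<alpha>..\<beta>}" "\<lambda>x. u x - h x"] x by auto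
  have neg_p: "u p < h p"
    using p(2)[of x] x neg by auto
  then have int: "\<alpha> < p" "p < \<beta>"
    using p(1) boundary by (cases "p = \<alpha>"; cases "p = \<beta>"; auto)+
  obtain d where d: "\<forall>x\<in>{\<alpha><..<\<beta>}. (u has_real_derivative d x) (at x) \<and>
        (\<exists>c. (d has_real_derivative c) (at x within {x..}) \<and>
             1/2 * (\<sigma> x)\<^sup>2 * c + \<mu> x * d x - r * u x \<le> 0)"
    using u(1) unfolding supersolution_on_def by (rule exE)
  then have du: "\<And>x. \<alpha> < x \<Longrightarrow> x < \<beta> \<Longrightarrow> (u has_real_derivative d x) (at x)"
    by simp
  have "p \<in> {\<alpha><..<\<beta>}"
    using int by simp
  then obtain c where c: "(d has_real_derivative c) (at p within {p..})"
    "1/2 * (\<sigma> p)\<^sup>2 * c + \<mu> p * d p - r * u p \<le> 0"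
    using d by blast
  have "((\<lambda>x. u x - h x) has_real_derivative (d p - h' p)) (at p)"
    using du[OF int] h(2)[OF int] by (rule DERIV_diff)
  moreover have "0 < min (p - \<alpha>) (\<beta> - p)"
    using int by auto
  moreover have "\<forall>y. \<bar>p - y\<bar> < min (p - \<alpha>) (\<beta> - p) \<longrightarrow> u p - h p \<le> u y - h y"
    by (auto intro!: p(2))
  ultimately have critical: "d p - h' p = 0"
    by (rule DERIV_local_min)
  have "0 \<le> c - h'' p"
  proof (rule second_derivative_nonneg_at_right_min[OF int(2)])
    show "((\<lambda>x. u x - h x) has_real_derivative (d x - h' x)) (at x)" if "p \<le> x" "x < \<beta>" for x
      using du[of x] h(2)[of x] that int by (intro DERIV_diff) auto
    show "((\<lambda>x. d x - h' x) has_real_derivative c - h'' p) (at p within {p..})"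
      using c(1) has_field_derivative_at_within[OF h(3)[OF int]] by (rule DERIV_diff)
  qed (use critical p(2) int in auto)
  then have "1/2 * (\<sigma> p)\<^sup>2 * h'' p \<le> 1/2 * (\<sigma> p)\<^sup>2 * c"
    by (intro mult_left_mono) auto
  then have "r * h p \<le> r * u p"
    using c(2) h(4)[OF int] critical by auto
  then show False
    using neg_p \<open>0 < r\<close> by auto
qed

lemma supersolution_discount_mono:
  assumes "supersolution_on \<mu> \<sigma> r A u" "r \<le> r'" "\<And>x. x \<in> A \<Longrightarrow> 0 \<le> u x"
  shows "supersolution_on \<mu> \<sigma> r' A u"
proof -
  have "r * u x \<le> r' * u x" if "x \<in> A" for x
    using assms(2,3) that by (intro mult_right_mono) auto
  then have "a - r' * u x \<le> 0" if "x \<in> A" "a - r * u x \<le> 0" for a x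
    using that by force
  then show ?thesis
    using assms(1) unfolding supersolution_on_def by meson
qed

lemma supersolution_add_const:
  assumes "supersolution_on \<mu> \<sigma> r A u" "0 \<le> r" "0 \<le> \<delta>"
  shows "supersolution_on \<mu> \<sigma> r A (\<lambda>x. u x + \<delta>)"
proof -
  obtain d where d: "\<And>x. x \<in> A \<Longrightarrow> (u has_real_derivative d x) (at x) \<and>
        (\<exists>c. (d has_real_derivative c) (at x within {x..}) \<and>
             1/2 * (\<sigma> x)\<^sup>2 * c + \<mu> x * d x - r * u x \<le> 0)"
    using assms(1) unfolding supersolution_on_def by blast
  have nonneg: "0 \<le> r * \<delta>"
    using assms by simp
  have "((\<lambda>x. u x + \<delta>) has_real_derivative d x) (at x) \<and>
        (\<exists>c. (d has_real_derivative c) (at x within {x..}) \<and>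
             1/2 * (\<sigma> x)\<^sup>2 * c + \<mu> x * d x - r * (u x + \<delta>) \<le> 0)" if x: "x \<in> A" for x
  proof -
    have "((\<lambda>x. u x + \<delta>) has_real_derivative d x + 0) (at x)"
      using d[OF x] by (intro DERIV_add) auto
    moreover obtain c where "(d has_real_derivative c) (at x within {x..})"
      "1/2 * (\<sigma> x)\<^sup>2 * c + \<mu> x * d x - r * u x \<le> 0"
      using d[OF x] by auto
    moreover have "r * (u x + \<delta>) = r * u x + r * \<delta>"
      by (rule distrib_left)
    ultimately show ?thesis
      using nonneg by (auto intro!: exI[of _ c])
  qed
  then show ?thesis
    unfolding supersolution_on_def by blast
qed

lemma supersolution_on_subset:
  "supersolution_on \<mu> \<sigma> r A u \<Longrightarrow> B \<subseteq> A \<Longrightarrow> supersolution_on \<mu> \<sigma> r B u"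
  unfolding supersolution_on_def by (meson subsetD)

lemma supersolution_onI:
  assumes "\<And>x. x \<in> A \<Longrightarrow> (u has_real_derivative d x) (at x)"
    and "\<And>x. x \<in> A \<Longrightarrow> (d has_real_derivative c x) (at x)"
    and "\<And>x. x \<in> A \<Longrightarrow> 1/2 * (\<sigma> x)\<^sup>2 * c x + \<mu> x * d x - r * u x \<le> 0"
  shows "supersolution_on \<mu> \<sigma> r A u"
proof -
  have "(u has_real_derivative d x) (at x) \<and> (\<exists>c. (d has_real_derivative c) (at x within {x..}) \<and>
      1/2 * (\<sigma> x)\<^sup>2 * c + \<mu> x * d x - r * u x \<le> 0)" if "x \<in> A" for x
    using assms(1)[OF that] has_field_derivative_at_within[OF assms(2)[OF that]] assms(3)[OF that]
    by blast
  then show ?thesis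
    unfolding supersolution_on_def by blast
qed

text \<open>
  Only the right-hand piece enters the second-order condition at the joint, so smooth fit of the
  values and first derivatives suffices.
\<close>

lemma supersolution_on_glue:
  assumes u1: "supersolution_on \<mu> \<sigma> r {0<..<p} u1" and u2: "supersolution_on \<mu> \<sigma> r {p..} u2"
    and fit: "u1 p = u2 p" "(u1 has_real_derivative D) (at p)" "(u2 has_real_derivative D) (at p)"
  shows "supersolution_on \<mu> \<sigma> r {0<..} (\<lambda>x. if x < p then u1 x else u2 x)"
proof -
  let ?u = "\<lambda>x. if x < p then u1 x else u2 x"
  obtain d1 where d1: "\<forall>x\<in>{0<..<p}. (u1 has_real_derivative d1 x) (at x) \<and>
        (\<exists>c. (d1 has_real_derivative c) (at x within {x..}) \<and>
             1/2 * (\<sigma> x)\<^sup>2 * c + \<mu> x * d1 x - r * u1 x \<le> 0)"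
    using u1 unfolding supersolution_on_def by (rule exE)
  obtain d2 where d2: "\<forall>x\<in>{p..}. (u2 has_real_derivative d2 x) (at x) \<and>
        (\<exists>c. (d2 has_real_derivative c) (at x within {x..}) \<and>
             1/2 * (\<sigma> x)\<^sup>2 * c + \<mu> x * d2 x - r * u2 x \<le> 0)"
    using u2 unfolding supersolution_on_def by (rule exE)
  have d2_p: "d2 p = D"
    using d2 fit(3) by (auto intro: DERIV_unique)
  let ?d = "\<lambda>x. if x < p then d1 x else d2 x"
  have "(?u has_real_derivative ?d x) (at x) \<and>
        (\<exists>c. (?d has_real_derivative c) (at x within {x..}) \<and>
             1/2 * (\<sigma> x)\<^sup>2 * c + \<mu> x * ?d x - r * ?u x \<le> 0)" if x: "0 < x" for x
  proof (cases "x < p")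
    case True
    then have mem: "x \<in> {0<..<p}"
      using x by simp
    then obtain c where c: "(d1 has_real_derivative c) (at x within {x..})"
      "1/2 * (\<sigma> x)\<^sup>2 * c + \<mu> x * d1 x - r * u1 x \<le> 0"
      using d1 by blast
    have "(u1 has_real_derivative d1 x) (at x)"
      using d1 mem by blast
    then have "(?u has_real_derivative d1 x) (at x)"
      by (rule has_field_derivative_transform_within_open[of _ _ _ "{..<p}"]) (use True in auto)
    moreover have "(?d has_real_derivative c) (at x within {x..})"
      using c(1) by (rule has_field_derivative_transform_within[of _ _ _ _ "p - x"])
        (use True in \<open>auto simp: dist_real_def\<close>)
    ultimately show ?thesis
      using True c(2) by auto
  next
    case False
    then have mem: "x \<in> {p..}"
      by simp
    then obtain c where c: "(d2 has_real_derivative c) (at x within {x..})"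
      "1/2 * (\<sigma> x)\<^sup>2 * c + \<mu> x * d2 x - r * u2 x \<le> 0"
      using d2 by blast
    have "(?u has_real_derivative d2 x) (at x)"
    proof (cases "x = p")
      case True
      then show ?thesis
        using has_real_derivative_glue[OF fit(2,3,1)] d2_p by simp
    next
      case ne: False
      have "(u2 has_real_derivative d2 x) (at x)"
        using d2 mem by blast
      then show ?thesis
        by (rule has_field_derivative_transform_within_open[of _ _ _ "{p<..}"])
          (use False ne in auto)
    qed
    moreover have "(?d has_real_derivative c) (at x within {x..})"
      using c(1) by (rule has_field_derivative_transform_within[of _ _ _ _ 1])
        (use False in auto)
    ultimately show ?thesis
      using False c(2) by auto
  qed
  then show ?thesis
    unfolding supersolution_on_def by (intro exI[of _ ?d]) auto
qed

section \<open>From monotone stopping sets to monotone levels\<close>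

text \<open>
  The level \<open>x\<^sub>1\<close> (\<open>x\<^sub>2\<close>) is the last (first) point of the stopping set before (after) \<open>l\<close>: the
  property that both descriptions of the levels share.
\<close>

definition lower_level :: "real set \<Rightarrow> real \<Rightarrow> real \<Rightarrow> bool" where
  "lower_level S l x \<longleftrightarrow> x \<in> S \<and> x < l \<and> S \<inter> {x<..l} = {}"

definition upper_level :: "real set \<Rightarrow> real \<Rightarrow> real \<Rightarrow> bool" where
  "upper_level S l x \<longleftrightarrow> x \<in> S \<and> l < x \<and> S \<inter> {l..<x} = {}"

lemma lower_level_mono:
  assumes "lower_level S l x" "lower_level S' l' x'" "l \<le> l'" "S \<inter> {..l} \<subseteq> S'"
  shows "x \<le> x'"
proof (rule ccontr)
  assume "\<not> x \<le> x'"
  moreover have "x \<in> S'"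
    using assms(1,4) by (auto simp: lower_level_def)
  ultimately have "x \<in> S' \<inter> {x'<..l'}"
    using assms(1,3) by (simp add: lower_level_def)
  then show False
    using assms(2) unfolding lower_level_def by blast
qed

lemma upper_level_mono:
  assumes "upper_level S l x" "upper_level S' l' x'" "l \<le> l'" "S' \<inter> {l'..} \<subseteq> S"
  shows "x \<le> x'"
proof (rule ccontr)
  assume "\<not> x \<le> x'"
  moreover have "x' \<in> S"
    using assms(2,4) by (auto simp: upper_level_def)
  ultimately have "x' \<in> S \<inter> {l..<x}"
    using assms(2,3) by (simp add: upper_level_def)
  then show False
    using assms(1) unfolding upper_level_def by blast
qed

lemma payoff_eq: "K < l \<Longrightarrow> payoff K l x = max l x - K"
  by (auto simp: payoff_def)

text \<open>
  The three payoff comparisons behind the transfer property: lowering \<open>K'\<close> to \<open>K\<close> adds \<open>K' - K\<close>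
  everywhere; raising \<open>l\<close> to \<open>l'\<close> adds \<open>l' - l\<close> below \<open>l\<close> and at most that elsewhere; lowering
  \<open>l'\<close> to \<open>l\<close> changes nothing above \<open>l'\<close> and adds nothing elsewhere.
\<close>

lemma levels_monotone:
  fixes S :: "real \<Rightarrow> real \<Rightarrow> real \<Rightarrow> real set"
  assumes lower: "\<And>r K l x. r \<in> R \<Longrightarrow> 0 < K \<Longrightarrow> K < l \<Longrightarrow> x1_is r K l x \<Longrightarrow>
        lower_level (S r K l) l x"
    and upper: "\<And>r K l x. r \<in> R \<Longrightarrow> 0 < K \<Longrightarrow> K < l \<Longrightarrow> x2_is r K l x \<Longrightarrow>
        upper_level (S r K l) l x"
    and S_r: "\<And>r r' K l. r \<in> R \<Longrightarrow> r' \<in> R \<Longrightarrow> 0 < K \<Longrightarrow> K < l \<Longrightarrow> r \<le> r' \<Longrightarrow>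
        S r K l \<subseteq> S r' K l"
    and transfer: "\<And>r K l K' l' \<delta> x. r \<in> R \<Longrightarrow> x \<in> S r K l \<Longrightarrow> 0 \<le> \<delta> \<Longrightarrow>
        (\<And>y. payoff K' l' y \<le> payoff K l y + \<delta>) \<Longrightarrow>
        payoff K' l' x = payoff K l x + \<delta> \<Longrightarrow> x \<in> S r K' l'"
  shows
    "(\<forall>r\<in>R. \<forall>r'\<in>R. \<forall>K l. 0 < K \<and> K < l \<and> r \<le> r' \<longrightarrow>
        (\<forall>x1 x1'. x1_is r K l x1 \<and> x1_is r' K l x1' \<longrightarrow> x1 \<le> x1') \<and>
        (\<forall>x2 x2'. x2_is r K l x2 \<and> x2_is r' K l x2' \<longrightarrow> x2' \<le> x2)) \<and>
     (\<forall>r\<in>R. \<forall>K K' l. 0 < K \<and> K \<le> K' \<and> K' < l \<longrightarrow>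
        (\<forall>x1 x1'. x1_is r K l x1 \<and> x1_is r K' l x1' \<longrightarrow> x1' \<le> x1) \<and>
        (\<forall>x2 x2'. x2_is r K l x2 \<and> x2_is r K' l x2' \<longrightarrow> x2 \<le> x2')) \<and>
     (\<forall>r\<in>R. \<forall>K l l'. 0 < K \<and> K < l \<and> l \<le> l' \<longrightarrow>
        (\<forall>x1 x1'. x1_is r K l x1 \<and> x1_is r K l' x1' \<longrightarrow> x1 \<le> x1') \<and>
        (\<forall>x2 x2'. x2_is r K l x2 \<and> x2_is r K l' x2' \<longrightarrow> x2 \<le> x2'))"
proof -
  have S_K: "S r K' l \<subseteq> S r K l" if "r \<in> R" "K \<le> K'" "K' < l" for r K K' l
    using transfer[of r _ K' l "K' - K" K l] that by (fastforce simp: payoff_def)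
  have S_l_below: "S r K l \<inter> {..l} \<subseteq> S r K l'" if "r \<in> R" "K < l" "l \<le> l'" for r K l l'
    using transfer[of r _ K l "l' - l" K l'] that by (fastforce simp: payoff_def)
  have S_l_above: "S r K l' \<inter> {l'..} \<subseteq> S r K l" if "r \<in> R" "K < l" "l \<le> l'" for r K l l'
    using transfer[of r _ K l' 0 K l] that by (fastforce simp: payoff_def)
  show ?thesis
  proof (intro conjI ballI allI impI)
    fix r r' K l x1 x1'
    assume "r \<in> R" "r' \<in> R" "0 < K \<and> K < l \<and> r \<le> r'" "x1_is r K l x1 \<and> x1_is r' K l x1'"
    then show "x1 \<le> x1'"
      using lower[of r K l x1] lower[of r' K l x1'] S_r[of r r' K l]
      by - (rule lower_level_mono[of "S r K l" l _ "S r' K l" l], auto)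
  next
    fix r r' K l x2 x2'
    assume "r \<in> R" "r' \<in> R" "0 < K \<and> K < l \<and> r \<le> r'" "x2_is r K l x2 \<and> x2_is r' K l x2'"
    then show "x2' \<le> x2"
      using upper[of r K l x2] upper[of r' K l x2'] S_r[of r r' K l]
      by - (rule upper_level_mono[of "S r' K l" l _ "S r K l" l], auto)
  next
    fix r K K' l x1 x1'
    assume "r \<in> R" "0 < K \<and> K \<le> K' \<and> K' < l" "x1_is r K l x1 \<and> x1_is r K' l x1'"
    then show "x1' \<le> x1"
      using lower[of r K l x1] lower[of r K' l x1'] S_K[of r K K' l]
      by - (rule lower_level_mono[of "S r K' l" l _ "S r K l" l], auto)
  next
    fix r K K' l x2 x2'
    assume "r \<in> R" "0 < K \<and> K \<le> K' \<and> K' < l" "x2_is r K l x2 \<and> x2_is r K' l x2'"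
    then show "x2 \<le> x2'"
      using upper[of r K l x2] upper[of r K' l x2'] S_K[of r K K' l]
      by - (rule upper_level_mono[of "S r K l" l _ "S r K' l" l], auto)
  next
    fix r K l l' x1 x1'
    assume "r \<in> R" "0 < K \<and> K < l \<and> l \<le> l'" "x1_is r K l x1 \<and> x1_is r K l' x1'"
    then show "x1 \<le> x1'"
      using lower[of r K l x1] lower[of r K l' x1'] S_l_below[of r K l l']
      by - (rule lower_level_mono[of "S r K l" l _ "S r K l'" l'], auto)
  next
    fix r K l l' x2 x2'
    assume "r \<in> R" "0 < K \<and> K < l \<and> l \<le> l'" "x2_is r K l x2 \<and> x2_is r K l' x2'"
    then show "x2 \<le> x2'"
      using upper[of r K l x2] upper[of r K l' x2'] S_l_above[of r K l l']
      by - (rule upper_level_mono[of "S r K l" l _ "S r K l'" l'], auto)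
  qed
qed

section \<open>The probabilistic stopping region\<close>

lemma discount_bounds: "0 \<le> discount r \<tau>" "0 \<le> r \<Longrightarrow> discount r \<tau> \<le> 1"
  by (auto simp: discount_def)

lemma discount_antimono: "r \<le> r' \<Longrightarrow> discount r' \<tau> \<le> discount r \<tau>"
  by (auto simp: discount_def intro!: mult_right_mono)

lemma payoff_nonneg: "0 \<le> payoff K l x"
  by (simp add: payoff_def)

text \<open>
  For arbitrary \<open>f\<close>, so that it applies directly to stopped payoffs: a simple function below \<open>f + c\<close> is at most \<open>c\<close> above its truncated
  difference with \<open>c\<close>, a measurable function below \<open>f\<close>.
\<close>

lemma (in prob_space) nn_integral_add_const_le:
  "(\<integral>\<^sup>+ \<omega>. f \<omega> + ennreal c \<partial>M) \<le> (\<integral>\<^sup>+ \<omega>. f \<omega> \<partial>M) + ennreal c"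
proof -
  have "integral\<^sup>S M g \<le> (\<integral>\<^sup>+ \<omega>. f \<omega> \<partial>M) + ennreal c"
    if g: "simple_function M g" "g \<le> (\<lambda>\<omega>. f \<omega> + ennreal c)" for g
  proof -
    have "integral\<^sup>S M g = (\<integral>\<^sup>+ \<omega>. g \<omega> \<partial>M)"
      using g(1) by (simp add: nn_integral_eq_simple_integral)
    also have "\<dots> \<le> (\<integral>\<^sup>+ \<omega>. (g \<omega> - ennreal c) + ennreal c \<partial>M)"
      by (intro nn_integral_mono) (metis add.commute ennreal_minus_le_iff ennreal_neq_top order_refl)
    also have "\<dots> = (\<integral>\<^sup>+ \<omega>. g \<omega> - ennreal c \<partial>M) + ennreal c"
      using borel_measurable_simple_function[OF g(1)]
      by (subst nn_integral_add) (auto simp: emeasure_space_1)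
    also have "\<dots> \<le> (\<integral>\<^sup>+ \<omega>. f \<omega> \<partial>M) + ennreal c"
      using g(2) by (intro add_right_mono nn_integral_mono)
        (simp add: le_fun_def ennreal_minus_le_iff add.commute)
    finally show ?thesis .
  qed
  then show ?thesis
    unfolding nn_integral_def[of M "\<lambda>\<omega>. f \<omega> + ennreal c"] by (intro SUP_least) auto
qed

context diffusion_setting
begin

text \<open>Stopping at time \<open>0\<close> yields the payoff at the starting point.\<close>

lemma payoff_le_value_function:
  assumes "0 < x"
  shows "ennreal (payoff K l x) \<le> value_function M \<F> X r K l x"
proof -
  have start: "AE \<omega> in M. X x 0 \<omega> = x"
    using solution[OF assms] by (simp add: strong_solution_def sde_solution_def)
  have "ennreal (payoff K l x) = (\<integral>\<^sup>+ \<omega>. ennreal (payoff K l x) \<partial>M)"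
    by (simp add: emeasure_space_1)
  also have "\<dots> = (\<integral>\<^sup>+ \<omega>. ennreal (discount r 0 * payoff K l (X x (enn2real 0) \<omega>)) \<partial>M)"
    using start by (intro nn_integral_cong_AE) (auto simp: discount_def)
  also have "\<dots> \<le> value_function M \<F> X r K l x"
    unfolding value_function_def
    by (rule SUP_upper2[of "\<lambda>_. 0"]) (auto simp: stopping_time_const)
  finally show ?thesis .
qed

lemma value_function_antimono_discount:
  assumes "r \<le> r'"
  shows "value_function M \<F> X r' K l x \<le> value_function M \<F> X r K l x"
  unfolding value_function_def using assms
  by (intro SUP_mono' nn_integral_mono ennreal_leI mult_right_mono discount_antimono payoff_nonneg)

text \<open>The discount factor is at most \<open>1\<close>, so an increase of the payoff by \<open>\<delta>\<close> is worth at most \<open>\<delta>\<close>.\<close>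

lemma value_function_le_add:
  assumes "0 \<le> r" "0 \<le> \<delta>" and le: "\<And>y. payoff K' l' y \<le> payoff K l y + \<delta>"
  shows "value_function M \<F> X r K' l' x \<le> value_function M \<F> X r K l x + ennreal \<delta>"
  unfolding value_function_def
proof (rule SUP_least)
  fix \<tau> assume \<tau>: "\<tau> \<in> {\<tau>. stopping_time \<F> \<tau>}"
  have "ennreal (discount r t * payoff K' l' y) \<le> ennreal (discount r t * payoff K l y) + ennreal \<delta>"
    for t y
  proof -
    have "discount r t * payoff K' l' y \<le> discount r t * (payoff K l y + \<delta>)"
      using le by (intro mult_left_mono discount_bounds)
    also have "\<dots> \<le> discount r t * payoff K l y + \<delta>"
      using mult_right_mono[OF discount_bounds(2)[OF \<open>0 \<le> r\<close>] \<open>0 \<le> \<delta>\<close>, of t]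
      by (simp add: distrib_left)
    finally show ?thesis
      using \<open>0 \<le> \<delta>\<close> by (simp add: ennreal_plus[symmetric] discount_bounds payoff_nonneg ennreal_leI
          del: ennreal_plus)
  qed
  then have "(\<integral>\<^sup>+ \<omega>. ennreal (discount r (\<tau> \<omega>) * payoff K' l' (X x (enn2real (\<tau> \<omega>)) \<omega>)) \<partial>M)
      \<le> (\<integral>\<^sup>+ \<omega>. ennreal (discount r (\<tau> \<omega>) * payoff K l (X x (enn2real (\<tau> \<omega>)) \<omega>)) + ennreal \<delta> \<partial>M)"
    by (intro nn_integral_mono)
  also have "\<dots> \<le> (\<integral>\<^sup>+ \<omega>. ennreal (discount r (\<tau> \<omega>) * payoff K l (X x (enn2real (\<tau> \<omega>)) \<omega>)) \<partial>M)
      + ennreal \<delta>"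
    by (rule nn_integral_add_const_le)
  also have "\<dots> \<le> (SUP \<tau> \<in> {\<tau>. stopping_time \<F> \<tau>}.
      \<integral>\<^sup>+ \<omega>. ennreal (discount r (\<tau> \<omega>) * payoff K l (X x (enn2real (\<tau> \<omega>)) \<omega>)) \<partial>M) + ennreal \<delta>"
    by (rule add_right_mono, rule SUP_upper[OF \<tau>])
  finally show "(\<integral>\<^sup>+ \<omega>. ennreal (discount r (\<tau> \<omega>) * payoff K' l' (X x (enn2real (\<tau> \<omega>)) \<omega>)) \<partial>M)
      \<le> \<dots>" .
qed

lemma stopping_region_mono_discount:
  assumes "r \<le> r'"
  shows "stopping_region M \<F> X r K l \<subseteq> stopping_region M \<F> X r' K l"
proof
  fix x assume x: "x \<in> stopping_region M \<F> X r K l"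
  then have "value_function M \<F> X r' K l x \<le> ennreal (payoff K l x)"
    using value_function_antimono_discount[OF assms, of K l x] by (simp add: stopping_region_def)
  then show "x \<in> stopping_region M \<F> X r' K l"
    using x payoff_le_value_function[of x K l r'] by (simp add: stopping_region_def)
qed

lemma stopping_region_transfer:
  assumes "0 \<le> r" "x \<in> stopping_region M \<F> X r K l" "0 \<le> \<delta>"
    and "\<And>y. payoff K' l' y \<le> payoff K l y + \<delta>" "payoff K' l' x = payoff K l x + \<delta>"
  shows "x \<in> stopping_region M \<F> X r K' l'"
proof -
  have x: "0 < x" "value_function M \<F> X r K l x = ennreal (payoff K l x)"
    using assms(2) by (auto simp: stopping_region_def)
  have "value_function M \<F> X r K' l' x \<le> ennreal (payoff K' l' x)"
    using value_function_le_add[OF assms(1,3,4), of x] x(2) assms(3,5)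
    by (simp add: payoff_nonneg)
  then show ?thesis
    using x(1) payoff_le_value_function[of x K' l' r] by (simp add: stopping_region_def)
qed

end

lemma region_x1_lower_level:
  assumes "region_x1 M \<F> X r K l x"
  shows "lower_level (stopping_region M \<F> X r K l) l x"
proof -
  have "x \<in> S \<and> S \<inter> {x<..l} = {}"
    if "0 < x" "S = {0<..x} \<or> (\<exists>x2>l. S = {0<..x} \<union> {x2..})" for S :: "real set"
    using that(2)
  proof (elim disjE exE conjE)
    show ?thesis if "S = {0<..x}"
      using \<open>0 < x\<close> unfolding that by auto
    show ?thesis if "l < x2" "S = {0<..x} \<union> {x2..}" for x2
      using \<open>0 < x\<close> that(1) unfolding that(2) by auto
  qed
  from this[of "stopping_region M \<F> X r K l"] show ?thesis
    using assms unfolding region_x1_def lower_level_def by blast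
qed

lemma region_x2_upper_level:
  assumes "region_x2 M \<F> X r K l x"
  shows "upper_level (stopping_region M \<F> X r K l) l x"
proof -
  obtain y where y: "y < l" "stopping_region M \<F> X r K l = {0<..y} \<union> {x..}" and x: "0 < y" "l < x"
    using assms unfolding region_x2_def by blast
  show ?thesis
    using x y(1) unfolding upper_level_def y(2) by auto
qed

section \<open>Contact sets of supersolutions\<close>

text \<open>
  The analytic counterpart of the stopping region, without reference to a value function: a least
  supersolution above the payoff would equal the payoff exactly where some such supersolution does.
\<close>

definition contact_set ::
  "(real \<Rightarrow> real) \<Rightarrow> (real \<Rightarrow> real) \<Rightarrow> real \<Rightarrow> real \<Rightarrow> real \<Rightarrow> real set" where
  "contact_set \<mu> \<sigma> r K l =
     {x. 0 < x \<and> (\<exists>u. supersolution_on \<mu> \<sigma> r {0<..} u \<and> (\<forall>y>0. payoff K l y \<le> u y) \<and>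
                       u x = payoff K l x)}"

lemma contact_set_mono_discount:
  assumes "r \<le> r'"
  shows "contact_set \<mu> \<sigma> r K l \<subseteq> contact_set \<mu> \<sigma> r' K l"
proof
  fix x assume "x \<in> contact_set \<mu> \<sigma> r K l"
  then obtain u where x: "0 < x" and u: "supersolution_on \<mu> \<sigma> r {0<..} u"
    "\<forall>y>0. payoff K l y \<le> u y" "u x = payoff K l x"
    unfolding contact_set_def by blast
  have "0 \<le> u y" if "y \<in> {0<..}" for y
    using payoff_nonneg[of K l y] u(2) that by force
  then have "supersolution_on \<mu> \<sigma> r' {0<..} u"
    by (rule supersolution_discount_mono[OF u(1) assms])
  then show "x \<in> contact_set \<mu> \<sigma> r' K l"
    using x u unfolding contact_set_def by blast
qed

lemma contact_set_transfer:
  assumes "0 \<le> r" "x \<in> contact_set \<mu> \<sigma> r K l" "0 \<le> \<delta>"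
    and le: "\<And>y. payoff K' l' y \<le> payoff K l y + \<delta>" and eq: "payoff K' l' x = payoff K l x + \<delta>"
  shows "x \<in> contact_set \<mu> \<sigma> r K' l'"
proof -
  obtain u where x: "0 < x" and u: "supersolution_on \<mu> \<sigma> r {0<..} u"
    "\<forall>y>0. payoff K l y \<le> u y" "u x = payoff K l x"
    using assms(2) unfolding contact_set_def by blast
  have "supersolution_on \<mu> \<sigma> r {0<..} (\<lambda>y. u y + \<delta>)"
    using u(1) assms(1,3) by (rule supersolution_add_const)
  moreover have "payoff K' l' y \<le> u y + \<delta>" if "0 < y" for y
    using le[of y] u(2) that by force
  ultimately show ?thesis
    using x u(3) eq unfolding contact_set_def by auto
qed

lemma payoff_deriv_below:
  assumes "K < l" "x < l"
  shows "(payoff K l has_real_derivative 0) (at x)"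
proof -
  have "((\<lambda>_. l - K) has_real_derivative 0) (at x)"
    by simp
  then show ?thesis
    by (rule has_field_derivative_transform_within_open[of _ _ _ "{..<l}"])
      (use assms in \<open>auto simp: payoff_eq\<close>)
qed

lemma payoff_deriv_above:
  assumes "K < l" "l < x"
  shows "(payoff K l has_real_derivative 1) (at x)"
proof -
  have "((\<lambda>x. x - K) has_real_derivative 1) (at x)"
    by (auto intro!: derivative_eq_intros)
  then show ?thesis
    by (rule has_field_derivative_transform_within_open[of _ _ _ "{l<..}"])
      (use assms in \<open>auto simp: payoff_eq\<close>)
qed

section \<open>Harmonic functions\<close>

text \<open>
  One discount rate together with the properties of the diffusion that enter the analysis:
  positivity of \<open>\<sigma>\<close> for dividing by \<open>\<sigma>\<^sup>2\<close>, the natural boundary for \<open>\<psi>(0+) = 0\<close>.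
\<close>

locale discount_problem = prob_space M + discount_setting M \<mu> \<sigma> X r \<psi> \<phi>
  for M :: "'a measure" and \<mu> \<sigma> :: "real \<Rightarrow> real" and X :: "real \<Rightarrow> real \<Rightarrow> 'a \<Rightarrow> real"
    and r :: real and \<psi> \<phi> :: "real \<Rightarrow> real" +
  assumes sigma_pos: "\<And>x. 0 < x \<Longrightarrow> 0 < \<sigma> x"
    and natural_boundary: "not_entrance_at_zero M X"
begin

abbreviation \<psi>' where "\<psi>' \<equiv> deriv \<psi>"
abbreviation \<phi>' where "\<phi>' \<equiv> deriv \<phi>"
abbreviation \<psi>'' where "\<psi>'' \<equiv> deriv \<psi>'"
abbreviation \<phi>'' where "\<phi>'' \<equiv> deriv \<phi>'"

lemma
  assumes "0 < x"
  shows psi_pos: "0 < \<psi> x"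
    and psi_deriv: "(\<psi> has_real_derivative \<psi>' x) (at x)"
    and psi_deriv2: "(\<psi>' has_real_derivative \<psi>'' x) (at x)"
    and psi_ode: "1/2 * (\<sigma> x)\<^sup>2 * \<psi>'' x + \<mu> x * \<psi>' x = r * \<psi> x"
  using assms psi_harmonic DERIV_deriv_iff_field_differentiable
  unfolding positive_r_harmonic_def C2_on_pos_def generator_def by auto

lemma
  assumes "0 < x"
  shows phi_pos: "0 < \<phi> x"
    and phi_deriv: "(\<phi> has_real_derivative \<phi>' x) (at x)"
    and phi_deriv2: "(\<phi>' has_real_derivative \<phi>'' x) (at x)"
    and phi_ode: "1/2 * (\<sigma> x)\<^sup>2 * \<phi>'' x + \<mu> x * \<phi>' x = r * \<phi> x"
  using assms phi_harmonic DERIV_deriv_iff_field_differentiable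
  unfolding positive_r_harmonic_def C2_on_pos_def generator_def by auto

lemma sigma_sq_pos: "0 < x \<Longrightarrow> 0 < (\<sigma> x)\<^sup>2"
  using sigma_pos[of x] by simp

text \<open>
  A zero of the derivative of a monotone function is an extremum of the derivative, so the second
  derivative vanishes there too, and the equation leaves \<open>r u = 0\<close>. The factor \<open>c = \<plusminus>1\<close> covers
  increasing and decreasing functions.
\<close>

lemma monotone_harmonic_deriv_nonzero:
  assumes "0 < x" and D: "\<And>y. 0 < y \<Longrightarrow> 0 \<le> c * u' y"
    and u': "(u' has_real_derivative u'') (at x)"
    and ode: "1/2 * (\<sigma> x)\<^sup>2 * u'' + \<mu> x * u' x = r * u" and "0 < u" and "c \<noteq> 0"
  shows "u' x \<noteq> 0"
proof
  assume zero: "u' x = 0"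
  have "((\<lambda>y. c * u' y) has_real_derivative c * u'') (at x)"
    by (intro DERIV_cmult u')
  moreover note \<open>0 < x\<close>
  moreover have "\<forall>y. \<bar>x - y\<bar> < x \<longrightarrow> c * u' x \<le> c * u' y"
    using D zero by auto
  ultimately have "c * u'' = 0"
    by (rule DERIV_local_min)
  then have "r * u = 0"
    using ode zero \<open>c \<noteq> 0\<close> by simp
  then show False
    using r_pos \<open>0 < u\<close> by simp
qed

lemma psi_deriv_pos:
  assumes "0 < x"
  shows "0 < \<psi>' x"
proof -
  have nonneg: "0 \<le> 1 * \<psi>' y" if y: "0 < y" for y
  proof (rule ccontr)
    assume "\<not> 0 \<le> 1 * \<psi>' y"
    then obtain e where e: "0 < e" "\<And>h. 0 < h \<Longrightarrow> h < e \<Longrightarrow> \<psi> (y + h) < \<psi> y"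
      using DERIV_neg_dec_right[OF psi_deriv[OF y]] by auto
    have "\<psi> (y + e/2) < \<psi> y"
      using e(1) by (intro e(2)) auto
    then show False
      using strict_mono_onD[OF psi_increasing, of y "y + e/2"] y e(1) by auto
  qed
  have "\<psi>' x \<noteq> 0"
    by (rule monotone_harmonic_deriv_nonzero[OF assms nonneg psi_deriv2[OF assms] psi_ode[OF assms]
          psi_pos[OF assms]]) auto
  then show ?thesis
    using nonneg[OF assms] by simp
qed

lemma phi_less: "0 < x \<Longrightarrow> x < y \<Longrightarrow> \<phi> y < \<phi> x"
  using phi_decreasing by (auto simp: monotone_on_def)

lemma psi_less: "0 < x \<Longrightarrow> x < y \<Longrightarrow> \<psi> x < \<psi> y"
  using psi_increasing by (auto simp: monotone_on_def)

lemma phi_deriv_neg: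
  assumes "0 < x"
  shows "\<phi>' x < 0"
proof -
  have nonneg: "0 \<le> (-1) * \<phi>' y" if y: "0 < y" for y
  proof (rule ccontr)
    assume "\<not> 0 \<le> (-1) * \<phi>' y"
    then have "0 < \<phi>' y"
      by simp
    then obtain e where e: "0 < e" "\<And>h. 0 < h \<Longrightarrow> h < e \<Longrightarrow> \<phi> y < \<phi> (y + h)"
      using DERIV_pos_inc_right[OF phi_deriv[OF y]] by auto
    have "\<phi> y < \<phi> (y + e/2)"
      using e(1) by (intro e(2)) auto
    then show False
      using phi_less[of y "y + e/2"] y e(1) by auto
  qed
  have "\<phi>' x \<noteq> 0"
    by (rule monotone_harmonic_deriv_nonzero[OF assms nonneg phi_deriv2[OF assms] phi_ode[OF assms]
          phi_pos[OF assms]]) auto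
  then show ?thesis
    using nonneg[OF assms] by simp
qed

definition wronskian :: "real \<Rightarrow> real" where
  "wronskian x = \<psi>' x * \<phi> x - \<psi> x * \<phi>' x"

lemma wronskian_pos: "0 < x \<Longrightarrow> 0 < wronskian x"
  using mult_pos_pos[OF psi_deriv_pos phi_pos, of x x] mult_pos_neg[OF psi_pos phi_deriv_neg, of x x]
  unfolding wronskian_def by simp

text \<open>
  The harmonic functions, together with their first two derivatives; after division by \<open>\<phi>\<close> and in
  the coordinate \<open>y = F(x)\<close> they are the lines \<open>a + b y\<close>.
\<close>

definition comb :: "real \<Rightarrow> real \<Rightarrow> real \<Rightarrow> real" where "comb a b x = a * \<phi> x + b * \<psi> x"
definition comb' :: "real \<Rightarrow> real \<Rightarrow> real \<Rightarrow> real" where "comb' a b x = a * \<phi>' x + b * \<psi>' x"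
definition comb'' :: "real \<Rightarrow> real \<Rightarrow> real \<Rightarrow> real" where "comb'' a b x = a * \<phi>'' x + b * \<psi>'' x"

lemma comb_deriv: "0 < x \<Longrightarrow> (comb a b has_real_derivative comb' a b x) (at x)"
  unfolding comb_def[abs_def] comb'_def
  using phi_deriv psi_deriv by (intro DERIV_add DERIV_cmult) auto

lemma comb_deriv2: "0 < x \<Longrightarrow> (comb' a b has_real_derivative comb'' a b x) (at x)"
  unfolding comb'_def[abs_def] comb''_def
  using phi_deriv2 psi_deriv2 by (intro DERIV_add DERIV_cmult) auto

lemma comb_ode:
  assumes "0 < x"
  shows "1/2 * (\<sigma> x)\<^sup>2 * comb'' a b x + \<mu> x * comb' a b x = r * comb a b x"
proof -
  have "1/2 * (\<sigma> x)\<^sup>2 * comb'' a b x + \<mu> x * comb' a b x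
      = a * (1/2 * (\<sigma> x)\<^sup>2 * \<phi>'' x + \<mu> x * \<phi>' x) + b * (1/2 * (\<sigma> x)\<^sup>2 * \<psi>'' x + \<mu> x * \<psi>' x)"
    unfolding comb'_def comb''_def by (simp add: algebra_simps)
  also have "\<dots> = r * comb a b x"
    unfolding phi_ode[OF assms] psi_ode[OF assms] comb_def by (simp add: algebra_simps)
  finally show ?thesis .
qed

lemma comb_continuous: "0 < \<alpha> \<Longrightarrow> continuous_on {\<alpha>..\<beta>} (comb a b)"
  by (intro continuous_at_imp_continuous_on ballI DERIV_isCont[OF comb_deriv]) auto

lemma comb_le_supersolution:
  assumes "0 < \<alpha>" and u: "supersolution_on \<mu> \<sigma> r {\<alpha>..\<beta>} u"
    and "comb a b \<alpha> \<le> u \<alpha>" "comb a b \<beta> \<le> u \<beta>" "\<alpha> \<le> x" "x \<le> \<beta>"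
  shows "comb a b x \<le> u x"
proof (rule harmonic_le_supersolution[where \<sigma> = \<sigma> and \<mu> = \<mu> and h = "comb a b"
      and h' = "comb' a b" and h'' = "comb'' a b"])
  show "supersolution_on \<mu> \<sigma> r {\<alpha><..<\<beta>} u"
    using u by (rule supersolution_on_subset) auto
  show "continuous_on {\<alpha>..\<beta>} u"
    using u unfolding supersolution_on_def
    by (auto intro!: continuous_at_imp_continuous_on) (metis DERIV_isCont atLeastAtMost_iff)
qed (use assms r_pos comb_deriv comb_deriv2 comb_ode comb_continuous in auto)

lemma comb_supersolution: "A \<subseteq> {0<..} \<Longrightarrow> supersolution_on \<mu> \<sigma> r A (comb a b)"
  by (rule supersolution_onI[where d = "comb' a b" and c = "comb'' a b"])
    (auto simp: comb_deriv comb_deriv2 comb_ode[simplified] subset_iff)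

lemma const_supersolution: "0 \<le> s \<Longrightarrow> supersolution_on \<mu> \<sigma> r A (\<lambda>_. s)"
  using r_pos by (intro supersolution_onI[where d = "\<lambda>_. 0" and c = "\<lambda>_. 0"]) auto

text \<open>
  \<open>-(\<L> - r)(x - K) = \<theta>(x) - r K\<close>, nondecreasing by the assumption on \<open>\<theta>\<close>: once \<open>x - K\<close> is a
  supersolution it remains one further right.
\<close>

definition drift_gap :: "real \<Rightarrow> real \<Rightarrow> real" where
  "drift_gap K x = r * x - \<mu> x - r * K"

lemma drift_gap_mono: "0 < x \<Longrightarrow> x \<le> y \<Longrightarrow> drift_gap K x \<le> drift_gap K y"
  using mono_onD[OF theta_mono, of x y] unfolding drift_gap_def by auto

lemma linear_supersolution:
  assumes "\<And>x. x \<in> A \<Longrightarrow> 0 \<le> drift_gap K x"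
  shows "supersolution_on \<mu> \<sigma> r A (\<lambda>x. x - K)"
proof (rule supersolution_onI[where d = "\<lambda>_. 1" and c = "\<lambda>_. 0"])
  show "((\<lambda>x. x - K) has_real_derivative 1) (at x)" for x
    by (auto intro!: derivative_eq_intros)
  show "1/2 * (\<sigma> x)\<^sup>2 * 0 + \<mu> x * 1 - r * (x - K) \<le> 0" if "x \<in> A" for x
    using assms[OF that] by (simp add: drift_gap_def algebra_simps)
qed auto

lemma excess_ode:
  assumes "0 < x"
  shows "1/2 * (\<sigma> x)\<^sup>2 * comb'' a b x + \<mu> x * (comb' a b x - 1) - r * (comb a b x - (x - K))
    = drift_gap K x"
  using comb_ode[OF assms, of a b] by (simp add: drift_gap_def algebra_simps)

text \<open>
  A positive solution of \<open>\<L> h = r h\<close> has no local maximum, so \<open>h\<close> rises from a positive critical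
  point for good.
\<close>

lemma comb_above_start:
  assumes "0 < x1" "x1 < x" and start: "comb a b x1 = s" "comb' a b x1 = 0" and "0 < s"
  shows "s < comb a b x"
proof (rule ccontr)
  assume below: "\<not> s < comb a b x"
  obtain m where m: "m \<in> {x1..x}" "\<And>y. y \<in> {x1..x} \<Longrightarrow> comb a b y \<le> comb a b m"
    using continuous_attains_sup[of "{x1..x}" "comb a b"] comb_continuous[of x1 x a b] assms by auto
  \<comment> \<open>At a maximum over \<open>[m, x)\<close> with vanishing derivative, \<open>h'' \<le> 0 < r h\<close> contradicts the equation.\<close>
  have no_max: False
    if m: "x1 \<le> m" "m < x" "comb' a b m = 0" "0 < comb a b m"
      "\<And>y. m \<le> y \<Longrightarrow> y < x \<Longrightarrow> comb a b y \<le> comb a b m" for m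
  proof -
    have "0 \<le> - comb'' a b m"
    proof (rule second_derivative_nonneg_at_right_min[where f = "\<lambda>y. - comb a b y"
          and d = "\<lambda>y. - comb' a b y", OF \<open>m < x\<close>])
      show "((\<lambda>y. - comb a b y) has_real_derivative - comb' a b y) (at y)" if "m \<le> y" for y
        using comb_deriv[of y] that \<open>x1 \<le> m\<close> \<open>0 < x1\<close> by (intro DERIV_minus) auto
      show "((\<lambda>y. - comb' a b y) has_real_derivative - comb'' a b m) (at m within {m..})"
        using \<open>x1 \<le> m\<close> \<open>0 < x1\<close>
        by (intro DERIV_minus[OF has_field_derivative_at_within[OF comb_deriv2]]) simp
    qed (use m in auto)
    then have "1/2 * (\<sigma> m)\<^sup>2 * comb'' a b m \<le> 0"
      by (simp add: mult_nonneg_nonpos)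
    moreover have "0 < r * comb a b m"
      using r_pos m(4) by simp
    ultimately show False
      using comb_ode[of m a b] m \<open>0 < x1\<close> by simp
  qed
  show False
  proof (cases "comb a b m \<le> s")
    case True
    show False
      using no_max[of x1] True m(2) start assms by force
  next
    case False
    then have int: "x1 < m" "m < x"
      using m(1) start below by (cases "m = x1"; cases "m = x"; auto)+
    have "comb' a b m = 0"
    proof (rule DERIV_local_max[OF comb_deriv])
      show "0 < min (m - x1) (x - m)"
        using int by simp
      show "\<forall>y. \<bar>m - y\<bar> < min (m - x1) (x - m) \<longrightarrow> comb a b y \<le> comb a b m"
        by (auto intro!: m(2))
    qed (use int assms in auto)
    then show False
      using no_max[of m] int m(2) False \<open>0 < s\<close> by auto
  qed
qed

section \<open>The scale function and the transformed payoff\<close>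

abbreviation F where "F \<equiv> F_fun \<psi> \<phi>"
abbreviation G where "G \<equiv> G_fun \<psi> \<phi>"

lemma F_pos: "0 < x \<Longrightarrow> 0 < F x"
  by (simp add: F_fun_def psi_pos phi_pos)

lemma F_less: "0 < x \<Longrightarrow> x < y \<Longrightarrow> F x < F y"
  unfolding F_fun_def by (intro frac_less) (use psi_less phi_less psi_pos phi_pos in \<open>auto intro: less_imp_le\<close>)

lemma F_inj: "inj_on F {0<..}"
  by (rule inj_onI) (metis F_less greaterThan_iff less_irrefl linorder_cases)

lemma F_inverse: "0 < x \<Longrightarrow> the_inv_into {0<..} F (F x) = x"
  by (rule the_inv_into_f_f[OF F_inj]) simp

lemma quotient_phi_deriv:
  assumes "0 < x" "(w has_real_derivative w') (at x)"
  shows "((\<lambda>x. w x / \<phi> x) has_real_derivative (w' * \<phi> x - w x * \<phi>' x) / (\<phi> x)\<^sup>2) (at x)"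
  using DERIV_divide[OF assms(2) phi_deriv[OF assms(1)]] phi_pos[OF assms(1)]
  by (simp add: power2_eq_square)

lemma F_deriv: "0 < x \<Longrightarrow> (F has_real_derivative wronskian x / (\<phi> x)\<^sup>2) (at x)"
  unfolding F_fun_def[abs_def] wronskian_def by (intro quotient_phi_deriv psi_deriv)

lemma F_continuous: "A \<subseteq> {0<..} \<Longrightarrow> continuous_on A F"
  by (auto intro!: continuous_at_imp_continuous_on DERIV_isCont[OF F_deriv])

lemma F_interval:
  assumes "0 < \<alpha>" "\<alpha> \<le> \<beta>" "F \<alpha> \<le> y" "y \<le> F \<beta>"
  obtains x where "\<alpha> \<le> x" "x \<le> \<beta>" "F x = y"
proof -
  have "continuous_on {\<alpha>..\<beta>} F"
    using assms(1) by (intro F_continuous) auto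
  then show thesis
    using IVT'[OF assms(3,4,2)] that by blast
qed

lemma G_at_F: "0 < x \<Longrightarrow> G K l (F x) = payoff K l x / \<phi> x"
  using F_pos[of x] by (simp add: G_fun_def F_inverse)

text \<open>Chain rule through \<open>F\<^sup>-\<^sup>1\<close>, with \<open>F' = wronskian / \<phi>\<^sup>2\<close>.\<close>

lemma G_deriv:
  assumes "0 < x" and g: "(payoff K l has_real_derivative g') (at x)"
  shows "(G K l has_real_derivative (g' * \<phi> x - payoff K l x * \<phi>' x) / wronskian x) (at (F x))"
proof -
  let ?I = "the_inv_into {0<..} F"
  have F'_ne: "wronskian x / (\<phi> x)\<^sup>2 \<noteq> 0"
    using wronskian_pos[OF assms(1)] phi_pos[OF assms(1)] by simp
  have "(?I has_derivative (*) (inverse (wronskian x / (\<phi> x)\<^sup>2))) (at (F x))"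
  proof (rule has_derivative_inverse_strong[of "{0<..}" x F ?I "(*) (wronskian x / (\<phi> x)\<^sup>2)"])
    show "(F has_derivative (*) (wronskian x / (\<phi> x)\<^sup>2)) (at x)"
      using F_deriv[OF assms(1)] by (simp add: has_field_derivative_def)
    show "(*) (wronskian x / (\<phi> x)\<^sup>2) \<circ> (*) (inverse (wronskian x / (\<phi> x)\<^sup>2)) = id"
      using F'_ne by (auto simp: fun_eq_iff)
  qed (use assms(1) in \<open>auto intro: F_continuous F_inverse\<close>)
  then have "(?I has_real_derivative inverse (wronskian x / (\<phi> x)\<^sup>2)) (at (F x))"
    by (simp add: has_field_derivative_def)
  moreover have "((\<lambda>x. payoff K l x / \<phi> x) has_real_derivative
      (g' * \<phi> x - payoff K l x * \<phi>' x) / (\<phi> x)\<^sup>2) (at (?I (F x)))"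
    using quotient_phi_deriv[OF assms] F_inverse[OF assms(1)] by simp
  ultimately have "((\<lambda>y. payoff K l (?I y) / \<phi> (?I y)) has_real_derivative
      (g' * \<phi> x - payoff K l x * \<phi>' x) / (\<phi> x)\<^sup>2 * inverse (wronskian x / (\<phi> x)\<^sup>2)) (at (F x))"
    by (rule DERIV_chain2[rotated])
  moreover have "(g' * \<phi> x - payoff K l x * \<phi>' x) / (\<phi> x)\<^sup>2 * inverse (wronskian x / (\<phi> x)\<^sup>2)
      = (g' * \<phi> x - payoff K l x * \<phi>' x) / wronskian x"
    using phi_pos[OF assms(1)] wronskian_pos[OF assms(1)] by (simp add: field_simps)
  ultimately have "((\<lambda>y. payoff K l (?I y) / \<phi> (?I y)) has_real_derivative
      (g' * \<phi> x - payoff K l x * \<phi>' x) / wronskian x) (at (F x))"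
    by (rule DERIV_cong)
  then show ?thesis
    by (rule has_field_derivative_transform_within_open[of _ _ _ "{0<..}"])
      (use F_pos[OF assms(1)] in \<open>auto simp: G_fun_def Let_def\<close>)
qed

text \<open>A line through the graph of \<open>G\<close> with the slope of \<open>G\<close> is a harmonic function meeting \<open>g\<close> smoothly.\<close>

lemma smooth_fit:
  assumes "0 < x" and g: "(payoff K l has_real_derivative g') (at x)"
    and "comb a b x = payoff K l x" and slope: "deriv (G K l) (F x) = b"
  shows "comb' a b x = g'"
proof -
  have "(g' * \<phi> x - payoff K l x * \<phi>' x) / wronskian x = b"
    using DERIV_imp_deriv[OF G_deriv[OF assms(1,2)]] slope by simp
  then have "g' * \<phi> x - payoff K l x * \<phi>' x = b * wronskian x"
    using wronskian_pos[OF assms(1)] by (simp add: field_simps)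
  then have "\<phi> x * g' = \<phi> x * comb' a b x"
    unfolding assms(3)[symmetric] comb_def comb'_def wronskian_def by (simp add: algebra_simps)
  then show ?thesis
    using phi_pos[OF assms(1)] by simp
qed

lemma psi_at_top: "filterlim \<psi> at_top at_top"
proof -
  have "\<forall>\<^sub>F x in at_top. \<psi> 1 + \<psi>' 1 * (x - 1) \<le> \<psi> x"
    unfolding eventually_at_top_linorder
  proof (intro exI[of _ 1] allI impI)
    fix x :: real assume "1 \<le> x"
    then have "\<psi> x - \<psi> 1 \<ge> \<psi>' 1 * (x - 1)"
      by (intro convex_on_imp_above_tangent[OF psi_convex]
          has_field_derivative_at_within[OF psi_deriv]) (auto simp: interior_open)
    then show "\<psi> 1 + \<psi>' 1 * (x - 1) \<le> \<psi> x"
      by simp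
  qed
  moreover have "filterlim (\<lambda>x. \<psi> 1 + \<psi>' 1 * (x - 1)) at_top at_top"
  proof (intro filterlim_tendsto_add_at_top[OF tendsto_const]
      filterlim_tendsto_pos_mult_at_top[OF tendsto_const])
    show "0 < \<psi>' 1"
      by (rule psi_deriv_pos) simp
    show "filterlim (\<lambda>x::real. x - 1) at_top at_top"
      using filterlim_tendsto_add_at_top[OF tendsto_const[of "-1::real"] filterlim_ident] by simp
  qed
  ultimately show ?thesis
    by (rule filterlim_at_top_mono[rotated])
qed

lemma F_at_top: "filterlim F at_top at_top"
proof -
  have "\<forall>\<^sub>F x in at_top. inverse (\<phi> 1) * \<psi> x \<le> F x"
    unfolding eventually_at_top_linorder
  proof (intro exI[of _ 1] allI impI)
    fix x :: real assume "1 \<le> x"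
    then have "\<phi> x \<le> \<phi> 1" "0 < \<phi> x" "0 < \<psi> x"
      using phi_less[of 1 x] phi_pos psi_pos by (cases "x = 1"; auto)+
    then show "inverse (\<phi> 1) * \<psi> x \<le> F x"
      unfolding F_fun_def by (simp add: field_simps mult_left_mono)
  qed
  moreover have "filterlim (\<lambda>x. inverse (\<phi> 1) * \<psi> x) at_top at_top"
    using phi_pos[of 1] by (intro filterlim_tendsto_pos_mult_at_top[OF tendsto_const _ psi_at_top]) auto
  ultimately show ?thesis
    by (rule filterlim_at_top_mono[rotated])
qed

lemma discount_ge_iff: "exp (- r * t) \<le> discount r \<tau> \<longleftrightarrow> \<tau> \<le> ennreal t" if "0 \<le> t"
proof (cases \<tau>)
  case (real s)
  then show ?thesis
    using r_pos that by (simp add: discount_def ennreal_le_iff)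
next
  case top
  then show ?thesis
    by (simp add: discount_def not_le top_unique)
qed

text \<open>
  \<open>\<psi>(x)/\<psi>(1)\<close> is the expected discount until the diffusion started at \<open>x\<close> reaches \<open>1\<close>. It is at most
  \<open>e\<^bsup>-rt\<^esup>\<close> plus the probability of getting there before \<open>t\<close>, which vanishes as \<open>x\<close> tends to \<open>0\<close>
  because \<open>0\<close> is not an entrance boundary.
\<close>

lemma psi_at_zero: "(\<psi> \<longlongrightarrow> 0) (at_right 0)"
proof (rule order_tendstoI)
  fix c :: real assume "c < 0"
  then show "\<forall>\<^sub>F x in at_right 0. c < \<psi> x"
    unfolding eventually_at_filter
    by (intro always_eventually allI impI) (use psi_pos in \<open>auto intro: less_trans\<close>)
next
  fix \<epsilon> :: real assume "0 < \<epsilon>"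
  \<comment> \<open>Half of the bound for the probability of an early hit, half for the discount after \<open>t\<close>.\<close>
  define \<delta> where "\<delta> = \<epsilon> / (2 * \<psi> 1)"
  have \<delta>: "0 < \<delta>"
    using \<open>0 < \<epsilon>\<close> psi_pos[of 1] by (simp add: \<delta>_def)
  define t where "t = max 0 (- ln \<delta> / r)"
  have t: "0 \<le> t" "exp (- r * t) \<le> \<delta>"
  proof -
    have "- ln \<delta> \<le> r * t"
      using r_pos unfolding t_def by (simp add: field_simps max_def)
    then have "exp (- r * t) \<le> exp (ln \<delta>)"
      by simp
    then show "exp (- r * t) \<le> \<delta>"
      using \<delta> by simp
  qed (simp add: t_def)
  define A where "A x = {\<omega> \<in> space M. hitting_time (X x) 1 \<omega> \<le> ennreal t}" for x
  have "((\<lambda>x. measure M (A x)) \<longlongrightarrow> 0) (at_right 0)"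
    using natural_boundary t(1) unfolding not_entrance_at_zero_def A_def by simp
  then have "\<forall>\<^sub>F x in at_right 0. measure M (A x) < \<delta>"
    using \<delta> by (rule order_tendstoD)
  moreover have "\<forall>\<^sub>F x in at_right (0::real). x \<in> {0<..<1}"
    by (rule eventually_at_right_real) simp
  ultimately show "\<forall>\<^sub>F x in at_right 0. \<psi> x < \<epsilon>"
  proof eventually_elim
    fix x assume small: "measure M (A x) < \<delta>" and x: "x \<in> {0<..<1}"
    define f where "f \<omega> = discount r (hitting_time (X x) 1 \<omega>)" for \<omega>
    have int_f: "(\<integral>\<omega>. f \<omega> \<partial>M) = \<psi> x / \<psi> 1"
      using psi_hitting[of x 1] x by (simp add: f_def)
    then have "(\<integral>\<omega>. f \<omega> \<partial>M) \<noteq> 0"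
      using psi_pos[of x] psi_pos[of 1] x by simp
    then have f: "integrable M f"
      using not_integrable_integral_eq by blast
    have "A x = {\<omega> \<in> space M. exp (- r * t) \<le> f \<omega>}"
      unfolding A_def f_def discount_ge_iff[OF t(1)] ..
    then have A: "A x \<in> sets M"
      using borel_measurable_integrable[OF f] by simp
    have "(\<integral>\<omega>. f \<omega> \<partial>M) \<le> (\<integral>\<omega>. indicator (A x) \<omega> + exp (- r * t) \<partial>M)"
    proof (rule integral_mono[OF f])
      show "integrable M (\<lambda>\<omega>. indicator (A x) \<omega> + exp (- r * t))"
        using A by (intro Bochner_Integration.integrable_add integrable_real_indicator)
          (auto simp: less_top[symmetric])
      show "f \<omega> \<le> indicator (A x) \<omega> + exp (- r * t)" if "\<omega> \<in> space M" for \<omega>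
      proof (cases "\<omega> \<in> A x")
        case True
        then show ?thesis
          using discount_bounds(2)[of r "hitting_time (X x) 1 \<omega>"] r_pos
          by (simp add: f_def add_increasing2)
      next
        case False
        then have "\<not> exp (- r * t) \<le> f \<omega>"
          using that unfolding A_def f_def discount_ge_iff[OF t(1)] by simp
        then show ?thesis
          using False by simp
      qed
    qed
    also have "\<dots> = measure M (A x) + exp (- r * t)"
      using A by (subst Bochner_Integration.integral_add) (auto simp: prob_space less_top[symmetric])
    also have "\<dots> < \<delta> + \<delta>"
      using small t(2) by simp
    finally have "\<psi> x / \<psi> 1 < 2 * \<delta>"
      using int_f by simp
    then show "\<psi> x < \<epsilon>"
      using psi_pos[of 1] by (simp add: \<delta>_def field_simps)
  qed
qed

lemma F_surj_below:
  assumes "0 < y" "y < F \<beta>" "0 < \<beta>"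
  obtains x where "0 < x" "x < \<beta>" "F x = y"
proof -
  have "0 < y * \<phi> \<beta>"
    using assms phi_pos by simp
  then have "\<forall>\<^sub>F x in at_right 0. \<psi> x < y * \<phi> \<beta>"
    by (rule order_tendstoD[OF psi_at_zero])
  moreover have "\<forall>\<^sub>F x in at_right (0::real). x \<in> {0<..<\<beta>}"
    using assms(3) by (rule eventually_at_right_real)
  ultimately have "\<forall>\<^sub>F x in at_right 0. \<psi> x < y * \<phi> \<beta> \<and> x \<in> {0<..<\<beta>}"
    by eventually_elim simp
  then obtain \<alpha> where \<alpha>: "\<psi> \<alpha> < y * \<phi> \<beta>" "0 < \<alpha>" "\<alpha> < \<beta>"
    using eventually_happens[of _ "at_right (0::real)"] by auto
  have "\<psi> \<alpha> < y * \<phi> \<alpha>"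
    using \<alpha>(1) mult_strict_left_mono[OF phi_less[OF \<alpha>(2,3)] assms(1)] by (rule less_trans)
  then have "F \<alpha> < y"
    using phi_pos[OF \<alpha>(2)] by (simp add: F_fun_def field_simps)
  obtain x where x: "\<alpha> \<le> x" "x \<le> \<beta>" "F x = y"
    by (rule F_interval[of \<alpha> \<beta> y, rotated 4]) (use \<alpha> assms \<open>F \<alpha> < y\<close> in auto)
  then have "x \<noteq> \<beta>"
    using assms(2) by auto
  then show thesis
    using that[of x] x \<alpha>(2) by simp
qed

lemma F_surj_above:
  assumes "0 < \<alpha>" "F \<alpha> \<le> y"
  obtains x where "\<alpha> \<le> x" "F x = y"
proof -
  have "\<forall>\<^sub>F x in at_top. y \<le> F x"
    using F_at_top by (simp add: filterlim_at_top)
  moreover have "\<forall>\<^sub>F x in at_top. \<alpha> \<le> x"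
    by (rule eventually_ge_at_top)
  ultimately have "\<forall>\<^sub>F x in at_top. y \<le> F x \<and> \<alpha> \<le> x"
    by eventually_elim simp
  then obtain \<beta> where \<beta>: "y \<le> F \<beta>" "\<alpha> \<le> \<beta>"
    using eventually_happens[of _ "at_top :: real filter"] trivial_limit_at_top_linorder by blast
  obtain x where "\<alpha> \<le> x" "F x = y"
    by (rule F_interval[OF assms(1) \<beta>(2) assms(2) \<beta>(1)])
  then show thesis
    by (rule that)
qed

text \<open>
  The limit exists because \<open>(\<psi>(x) - \<psi>(K)) / (x - K)\<close> is nondecreasing by convexity, and the
  subtracted \<open>\<psi>(K)\<close> is negligible as \<open>\<psi>\<close> diverges.
\<close>

lemma L_infinity_tendsto:
  assumes "0 < K" "K < l"
  shows "((\<lambda>x. (x - K) / \<psi> x) \<longlongrightarrow> L_infinity \<psi> K l) at_top"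
proof -
  let ?f = "\<lambda>x. (x - K) / (\<psi> x - \<psi> K)"
  have "\<exists>L. (?f \<longlongrightarrow> L) at_top"
  proof (rule antimono_bounded_below_converges[of l])
    fix x assume "l \<le> x"
    then show "0 \<le> ?f x"
      using psi_less[of K x] assms by simp
  next
    fix x y assume xy: "l \<le> x" "x \<le> y"
    show "?f y \<le> ?f x"
    proof (cases "x = y")
      case False
      have pos: "0 < \<psi> x - \<psi> K" "0 < \<psi> y - \<psi> K"
        using psi_less[of K x] psi_less[of K y] assms xy by auto
      have "(\<psi> K - \<psi> x) / (K - x) \<le> (\<psi> K - \<psi> y) / (K - y)"
        using assms xy False by (intro convex_on_slope_le(1)[OF psi_convex]) auto
      then have "(\<psi> x - \<psi> K) / (x - K) \<le> (\<psi> y - \<psi> K) / (y - K)"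
        by (metis minus_diff_eq minus_divide_divide)
      then show ?thesis
        using pos assms xy by (simp add: field_simps)
    qed simp
  qed
  then obtain L where "(?f \<longlongrightarrow> L) at_top" ..
  moreover have "((\<lambda>x. 1 - \<psi> K / \<psi> x) \<longlongrightarrow> 1 - 0) at_top"
    by (intro tendsto_diff tendsto_const tendsto_divide_0[OF tendsto_const]
        filterlim_at_top_imp_at_infinity psi_at_top)
  ultimately have "((\<lambda>x. ?f x * (1 - \<psi> K / \<psi> x)) \<longlongrightarrow> L * (1 - 0)) at_top"
    by (rule tendsto_mult)
  moreover have "\<forall>\<^sub>F x in at_top. ?f x * (1 - \<psi> K / \<psi> x) = (x - K) / \<psi> x"
    unfolding eventually_at_top_linorder
  proof (intro exI[of _ l] allI impI)
    fix x assume "l \<le> x"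
    then have "0 < \<psi> x - \<psi> K" "0 < \<psi> x"
      using psi_less[of K x] psi_pos[of x] assms by auto
    then show "?f x * (1 - \<psi> K / \<psi> x) = (x - K) / \<psi> x"
      by (simp add: field_simps)
  qed
  ultimately have lim: "((\<lambda>x. (x - K) / \<psi> x) \<longlongrightarrow> L) at_top"
    by (simp add: tendsto_cong)
  have "\<forall>\<^sub>F x in at_top. (x - K) / \<psi> x = payoff K l x / \<psi> x"
    using eventually_ge_at_top[of l] by eventually_elim (simp add: payoff_eq assms max_def)
  then have "((\<lambda>x. payoff K l x / \<psi> x) \<longlongrightarrow> L) at_top"
    using lim by (rule Lim_transform_eventually[rotated])
  then have "L_infinity \<psi> K l = L"
    unfolding L_infinity_def by (intro tendsto_Lim) auto
  then show ?thesis
    using lim by simp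
qed

lemma phi_over_psi_at_top: "((\<lambda>x. \<phi> x / \<psi> x) \<longlongrightarrow> 0) at_top"
  by (rule tendsto_divide_0[OF phi_at_top filterlim_at_top_imp_at_infinity[OF psi_at_top]])

lemma comb_over_psi_at_top: "((\<lambda>x. comb a b x / \<psi> x) \<longlongrightarrow> b) at_top"
proof -
  have "((\<lambda>x. a * (\<phi> x / \<psi> x) + b) \<longlongrightarrow> a * 0 + b) at_top"
    by (intro tendsto_intros phi_over_psi_at_top)
  moreover have "\<forall>\<^sub>F x in at_top. a * (\<phi> x / \<psi> x) + b = comb a b x / \<psi> x"
    using eventually_gt_at_top[of 0]
  proof eventually_elim
    fix x :: real assume "0 < x"
    then show "a * (\<phi> x / \<psi> x) + b = comb a b x / \<psi> x"
      using psi_pos[of x] by (simp add: comb_def field_simps)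
  qed
  ultimately show ?thesis
    by (simp add: tendsto_cong)
qed

section \<open>Levels from a double tangency\<close>

text \<open>
  The common tangent of \<open>G\<close> at \<open>F(x\<^sub>1)\<close> and \<open>F(x\<^sub>2)\<close> as a harmonic function \<open>h\<close>. Strict concavity
  of \<open>G\<close> beyond \<open>F(x\<^sub>g)\<close> enters through the last property alone: there the tangent lies
  strictly above \<open>G\<close> except at \<open>F(x\<^sub>2)\<close>.
\<close>

lemma double_tangency_smooth_fit:
  assumes K: "0 < K" "K < l" and dt: "double_tangency \<psi> \<phi> K l x1 x2"
  obtains a b y0 where "0 < x1" "x1 < l" "l \<le> y0" "y0 < x2"
    "comb a b x1 = l - K" "comb' a b x1 = 0" "comb a b x2 = x2 - K" "comb' a b x2 = 1"
    "\<forall>x>y0. x \<noteq> x2 \<longrightarrow> x - K < comb a b x"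
proof -
  define b where "b = (G K l (F x2) - G K l (F x1)) / (F x2 - F x1)"
  obtain xg where x1: "0 < x1" "x1 < l" and xg: "is_x_g \<psi> \<phi> K l xg" "xg < ereal x2"
    and slopes: "deriv (G K l) (F x1) = b" "deriv (G K l) (F x2) = b"
  proof -
    have "0 < x1 \<and> x1 < l \<and> (\<exists>xg. is_x_g \<psi> \<phi> K l xg \<and> xg < ereal x2) \<and>
        deriv (G K l) (F x1) = b \<and> b = deriv (G K l) (F x2)"
      using dt unfolding double_tangency_def Let_def b_def .
    then show ?thesis
      using that by metis
  qed
  obtain y0 where y0: "xg = ereal y0"
    using xg unfolding is_x_g_def by (cases xg) auto
  have y0_bounds: "l \<le> y0" "y0 < x2"
    using xg y0 unfolding is_x_g_def by auto
  define S where "S = F ` {x. y0 < x}"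
  have concave: "strictly_concave_on S (G K l)"
    using xg(1) y0 unfolding is_x_g_def S_def by simp
  define a where "a = G K l (F x1) - b * F x1"
  have comb_G: "comb a b x = (a + b * F x) * \<phi> x" if "0 < x" for x
    using phi_pos[OF that] by (simp add: comb_def F_fun_def field_simps)
  have "F x1 < F x2"
    using x1 y0_bounds by (intro F_less) auto
  then have "b * (F x2 - F x1) = G K l (F x2) - G K l (F x1)"
    by (simp add: b_def)
  then have G2: "G K l (F x2) = a + b * F x2"
    by (simp add: a_def algebra_simps)
  have G1: "G K l (F x1) = a + b * F x1"
    by (simp add: a_def)
  have G_phi: "G K l (F x) * \<phi> x = payoff K l x" if "0 < x" for x
    using phi_pos[OF that] by (simp add: G_at_F that)
  have x2_pos: "0 < x2"
    using x1 y0_bounds by simp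
  have fit1: "comb a b x1 = payoff K l x1"
    using comb_G[OF x1(1)] G_phi[OF x1(1)] G1 by simp
  have fit2: "comb a b x2 = payoff K l x2"
    using comb_G[OF x2_pos] G_phi[OF x2_pos] G2 by simp
  have "l < x2"
    using y0_bounds by simp
  note g2 = payoff_deriv_above[OF K(2) \<open>l < x2\<close>]
  have above: "x - K < comb a b x" if x: "y0 < x" "x \<noteq> x2" for x
  proof -
    have x_pos: "0 < x"
      using x y0_bounds K by simp
    have "F x2 \<in> interior S"
    proof (rule interiorI)
      define \<alpha> where "\<alpha> = (y0 + x2) / 2"
      have \<alpha>: "y0 < \<alpha>" "\<alpha> < x2"
        using y0_bounds unfolding \<alpha>_def by auto
      show "F x2 \<in> {F \<alpha><..<F (x2 + 1)}"
        using F_less[of \<alpha> x2] F_less[of x2 "x2 + 1"] \<alpha> y0_bounds K by auto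
      show "{F \<alpha><..<F (x2 + 1)} \<subseteq> S"
      proof
        fix y assume y: "y \<in> {F \<alpha><..<F (x2 + 1)}"
        obtain z where "\<alpha> \<le> z" "F z = y"
          by (rule F_interval[of \<alpha> "x2 + 1" y, rotated 4]) (use \<alpha> y0_bounds K y in auto)
        then show "y \<in> S"
          using \<alpha> by (auto simp: S_def)
      qed
    qed simp
    moreover have "(G K l has_real_derivative b) (at (F x2))"
      using G_deriv[OF x2_pos g2] DERIV_imp_deriv[OF G_deriv[OF x2_pos g2]] slopes(2) by simp
    moreover have "F x \<in> S"
      using x by (auto simp: S_def)
    moreover have "F x \<noteq> F x2"
      using inj_onD[OF F_inj, of x x2] x_pos x2_pos x(2) by auto
    ultimately have "G K l (F x) < G K l (F x2) + b * (F x - F x2)"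
      by (rule strictly_concave_below_tangent[OF concave])
    then have "G K l (F x) < a + b * F x"
      using G2 by (simp add: algebra_simps)
    then have "payoff K l x < comb a b x"
      unfolding comb_G[OF x_pos] G_phi[OF x_pos, symmetric]
      using phi_pos[OF x_pos] by (rule mult_strict_right_mono)
    then show ?thesis
      using x y0_bounds K(2) by (simp add: payoff_eq)
  qed
  show thesis
  proof (rule that[OF x1 y0_bounds])
    show "comb a b x1 = l - K"
      using fit1 x1 K by (simp add: payoff_eq)
    show "comb' a b x1 = 0"
      by (rule smooth_fit[OF x1(1) payoff_deriv_below[OF K(2) x1(2)] fit1 slopes(1)])
    show "comb a b x2 = x2 - K"
      using fit2 \<open>l < x2\<close> K by (simp add: payoff_eq)
    show "comb' a b x2 = 1"
      by (rule smooth_fit[OF x2_pos g2 fit2 slopes(2)])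
  qed (use above in blast)
qed

text \<open>The difference \<open>h - (x - K)\<close> is called the excess of \<open>h\<close>.\<close>

lemma excess_deriv: "0 < x \<Longrightarrow> ((\<lambda>x. comb a b x - (x - K)) has_real_derivative comb' a b x - 1) (at x)"
  by (auto intro!: derivative_eq_intros comb_deriv)

lemma excess_deriv2:
  "0 < x \<Longrightarrow> ((\<lambda>x. comb' a b x - 1) has_real_derivative comb'' a b x) (at x)"
  by (auto intro!: derivative_eq_intros comb_deriv2)

text \<open>
  The excess \<open>w\<close> satisfies \<open>\<L> w - r w = \<theta> - r K\<close>, and at a minimum \<open>\<L> w \<ge> 0\<close>.
\<close>

lemma drift_gap_at_right_min:
  assumes "0 < m" "m < \<beta>" "comb' a b m = 1"
    and min: "\<And>y. m \<le> y \<Longrightarrow> y < \<beta> \<Longrightarrow> comb a b m - (m - K) \<le> comb a b y - (y - K)"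
  shows "- r * (comb a b m - (m - K)) \<le> drift_gap K m"
proof -
  have "0 \<le> comb'' a b m"
  proof (rule second_derivative_nonneg_at_right_min[where f = "\<lambda>x. comb a b x - (x - K)"
        and d = "\<lambda>x. comb' a b x - 1", OF \<open>m < \<beta>\<close>])
    show "((\<lambda>x. comb' a b x - 1) has_real_derivative comb'' a b m) (at m within {m..})"
      by (rule has_field_derivative_at_within[OF excess_deriv2[OF \<open>0 < m\<close>]])
  qed (use assms excess_deriv in auto)
  then have "0 \<le> 1/2 * (\<sigma> m)\<^sup>2 * comb'' a b m"
    by simp
  then show ?thesis
    using excess_ode[OF \<open>0 < m\<close>, of a b K] assms(3) by simp
qed

lemma drift_gap_at_interior_min:
  assumes "0 < \<alpha>" "\<alpha> < m" "m < \<beta>"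
    and min: "\<And>y. \<alpha> \<le> y \<Longrightarrow> y \<le> \<beta> \<Longrightarrow> comb a b m - (m - K) \<le> comb a b y - (y - K)"
  shows "- r * (comb a b m - (m - K)) \<le> drift_gap K m"
proof (rule drift_gap_at_right_min)
  have "comb' a b m - 1 = 0"
  proof (rule DERIV_local_min[OF excess_deriv])
    show "0 < min (m - \<alpha>) (\<beta> - m)"
      using assms by simp
    show "\<forall>y. \<bar>m - y\<bar> < min (m - \<alpha>) (\<beta> - m) \<longrightarrow> comb a b m - (m - K) \<le> comb a b y - (y - K)"
    proof (intro allI impI)
      fix y assume "\<bar>m - y\<bar> < min (m - \<alpha>) (\<beta> - m)"
      then show "comb a b m - (m - K) \<le> comb a b y - (y - K)"
        by (intro min) auto
    qed
  qed (use assms in simp)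
  then show "comb' a b m = 1"
    by simp
qed (use assms in auto)

lemma excess_attains_min:
  assumes "0 < \<alpha>" "\<alpha> \<le> \<beta>"
  obtains m where "\<alpha> \<le> m" "m \<le> \<beta>"
    "\<forall>y. \<alpha> \<le> y \<and> y \<le> \<beta> \<longrightarrow> comb a b m - (m - K) \<le> comb a b y - (y - K)"
proof -
  have "continuous_on {\<alpha>..\<beta>} (\<lambda>x. comb a b x - (x - K))"
    using comb_continuous[OF assms(1)] by (intro continuous_intros)
  moreover have "compact {\<alpha>..\<beta>}" "{\<alpha>..\<beta>} \<noteq> {}"
    using assms(2) by auto
  ultimately obtain m where "m \<in> {\<alpha>..\<beta>}"
    "\<forall>y\<in>{\<alpha>..\<beta>}. comb a b m - (m - K) \<le> comb a b y - (y - K)"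
    using continuous_attains_inf by blast
  then show thesis
    by (intro that[of m]) auto
qed

text \<open>
  If the excess were not positive, it would have a nonpositive interior minimum \<open>p\<close>. There
  \<open>\<theta> - r K \<ge> 0\<close>, hence on all of \<open>[p, x\<^sub>2]\<close> by monotonicity, so \<open>x - K\<close> is a supersolution on this
  interval that dominates \<open>h\<close> at both ends and therefore inside, against positivity just before \<open>x\<^sub>2\<close>.
\<close>

lemma excess_positive_between:
  assumes "0 < l" "l - K < comb a b l" and y0: "l \<le> y0" "y0 < x2" and "comb a b x2 = x2 - K"
    and near: "\<And>x. y0 < x \<Longrightarrow> x < x2 \<Longrightarrow> x - K < comb a b x" and x: "l \<le> x" "x < x2"
  shows "x - K < comb a b x"
proof (rule ccontr)
  assume neg: "\<not> x - K < comb a b x"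
  obtain m where m: "l \<le> m" "m \<le> x2"
    "\<forall>y. l \<le> y \<and> y \<le> x2 \<longrightarrow> comb a b m - (m - K) \<le> comb a b y - (y - K)"
    by (rule excess_attains_min[of l x2 a b K]) (use assms(1) y0 in auto)
  \<comment> \<open>The minimum may also be attained at \<open>x2\<close>; in that case \<open>x\<close> is a minimiser too.\<close>
  define p where "p = (if m = x2 then x else m)"
  have p: "l < p" "p < x2" "comb a b p - (p - K) \<le> 0"
    "\<And>y. l \<le> y \<Longrightarrow> y \<le> x2 \<Longrightarrow> comb a b p - (p - K) \<le> comb a b y - (y - K)"
  proof -
    have le: "comb a b p - (p - K) \<le> comb a b m - (m - K)"
      using neg assms(5) by (simp add: p_def)
    show "\<And>y. l \<le> y \<Longrightarrow> y \<le> x2 \<Longrightarrow> comb a b p - (p - K) \<le> comb a b y - (y - K)"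
      using m(3) le order_trans by blast
    show nonpos: "comb a b p - (p - K) \<le> 0"
      using le m(3)[rule_format, of x2] assms(5) x by simp
    show "p < x2"
      using m x by (simp add: p_def)
    have "l \<le> p"
      using m x by (simp add: p_def)
    moreover have "p \<noteq> l"
      using nonpos assms(2) by auto
    ultimately show "l < p"
      by simp
  qed
  have "0 \<le> - r * (comb a b p - (p - K))"
    using p(3) r_pos by (simp add: mult_nonneg_nonpos)
  also have "\<dots> \<le> drift_gap K p"
    by (rule drift_gap_at_interior_min[OF assms(1) p(1,2,4)])
  finally have gap: "0 \<le> drift_gap K z" if "z \<in> {p..x2}" for z
    using drift_gap_mono[of p z K] that p(1) assms(1) by simp
  define z where "z = (max p y0 + x2) / 2"
  have z: "p \<le> z" "z < x2" "y0 < z"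
    using p(2) y0(2) unfolding z_def by (auto simp: max_def field_simps)
  have lin: "supersolution_on \<mu> \<sigma> r {p..x2} (\<lambda>x. x - K)"
    by (rule linear_supersolution) (rule gap)
  have "comb a b z \<le> z - K"
    by (rule comb_le_supersolution[where u = "\<lambda>x. x - K", OF _ lin])
      (use p assms(1,5) z in auto)
  then show False
    using near[OF z(3,2)] by simp
qed

text \<open>
  The excess is nonnegative to the right of \<open>x\<^sub>2\<close> and vanishes there together with its derivative,
  which forces \<open>\<theta>(x\<^sub>2) \<ge> r K\<close>; this makes \<open>x - K\<close> a supersolution from \<open>x\<^sub>2\<close> on and the glued
  function \<open>v\<close> below a supersolution touching the payoff at both levels.
\<close>

lemma double_tangency_levels:
  assumes K: "0 < K" "K < l" and dt: "double_tangency \<psi> \<phi> K l x1 x2"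
  shows "lower_level (contact_set \<mu> \<sigma> r K l) l x1" "upper_level (contact_set \<mu> \<sigma> r K l) l x2"
proof -
  obtain a b y0 where x1: "0 < x1" "x1 < l" and y0: "l \<le> y0" "y0 < x2"
    and fit1: "comb a b x1 = l - K" "comb' a b x1 = 0"
    and fit2: "comb a b x2 = x2 - K" "comb' a b x2 = 1"
    and tangent: "\<forall>x>y0. x \<noteq> x2 \<longrightarrow> x - K < comb a b x"
    by (rule double_tangency_smooth_fit[OF K dt])
  note above = tangent[rule_format]
  have x2: "l < x2" "0 < x2"
    using y0 K by auto
  have above_s: "l - K < comb a b x" if "x1 < x" for x
    by (rule comb_above_start[OF x1(1) that fit1]) (use K in simp)
  have excess: "x - K < comb a b x" if "l \<le> x" "x < x2" for x
    by (rule excess_positive_between[of l K a b y0 x2])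
      (use K x1 y0 fit2 above above_s that in auto)
  have strict: "payoff K l x < comb a b x" if "x1 < x" "x < x2" for x
    using above_s[OF that(1)] excess[OF _ that(2)] K by (auto simp: payoff_eq max_def)
  have "- r * (comb a b x2 - (x2 - K)) \<le> drift_gap K x2"
  proof (rule drift_gap_at_right_min[OF x2(2) _ fit2(2)])
    show "comb a b x2 - (x2 - K) \<le> comb a b y - (y - K)" if "x2 \<le> y" for y
      using above[of y] that y0 fit2(1) by (cases "y = x2") auto
  qed (rule less_add_one)
  then have gap: "0 \<le> drift_gap K x" if "x \<in> {x2..}" for x
    using drift_gap_mono[of x2 x K] that x2 fit2(1) by simp
  have lin: "((\<lambda>x. x - K) has_real_derivative 1) (at x2)"
    by (auto intro!: derivative_eq_intros)
  have super_lin: "supersolution_on \<mu> \<sigma> r {x2..} (\<lambda>x. x - K)"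
    by (rule linear_supersolution) (rule gap)
  \<comment> \<open>The candidate value function, glued in two steps at \<open>x2\<close> and \<open>x1\<close>.\<close>
  define k where "k x = (if x < x2 then comb a b x else x - K)" for x
  have "supersolution_on \<mu> \<sigma> r {0<..} k"
    unfolding k_def
    by (rule supersolution_on_glue[OF comb_supersolution super_lin fit2(1) _ lin])
      (use comb_deriv[OF x2(2), of a b] fit2(2) in auto)
  define v where "v x = (if x < x1 then l - K else k x)" for x
  have k_x1: "(k has_real_derivative 0) (at x1)"
  proof (rule has_field_derivative_transform_within_open[of "comb a b" _ _ "{..<x2}"])
    show "(comb a b has_real_derivative 0) (at x1)"
      using comb_deriv[OF x1(1), of a b] fit1(2) by simp
  qed (use x1 x2 in \<open>auto simp: k_def\<close>)
  have "supersolution_on \<mu> \<sigma> r {0<..} v"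
    unfolding v_def
  proof (rule supersolution_on_glue[OF const_supersolution _ _ _ k_x1])
    show "supersolution_on \<mu> \<sigma> r {x1..} k"
      using \<open>supersolution_on \<mu> \<sigma> r {0<..} k\<close> by (rule supersolution_on_subset) (use x1 in auto)
  qed (use K x1 x2 fit1 in \<open>auto simp: k_def\<close>)
  moreover have "payoff K l x \<le> v x" for x
  proof -
    consider "x \<le> x1" | "x1 < x" "x < x2" | "x2 \<le> x"
      by linarith
    then show ?thesis
      using strict[of x] x1 x2 fit1 K by cases (auto simp: v_def k_def payoff_eq)
  qed
  moreover have "v x1 = payoff K l x1" "v x2 = payoff K l x2"
    using x1 x2 K fit1 by (auto simp: v_def k_def payoff_eq)
  ultimately have mem: "x1 \<in> contact_set \<mu> \<sigma> r K l" "x2 \<in> contact_set \<mu> \<sigma> r K l"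
    using x1 x2 unfolding contact_set_def by blast+
  have gap_free: "x \<notin> contact_set \<mu> \<sigma> r K l" if x: "x1 < x" "x < x2" for x
  proof
    assume "x \<in> contact_set \<mu> \<sigma> r K l"
    then obtain u where u: "supersolution_on \<mu> \<sigma> r {0<..} u" "\<And>y. 0 < y \<Longrightarrow> payoff K l y \<le> u y"
      "u x = payoff K l x"
      unfolding contact_set_def by blast
    have "comb a b x \<le> u x"
    proof (rule comb_le_supersolution[OF x1(1)])
      show "supersolution_on \<mu> \<sigma> r {x1..x2} u"
        using u(1) by (rule supersolution_on_subset) (use x1 in auto)
      show "comb a b x1 \<le> u x1" "comb a b x2 \<le> u x2"
        using u(2)[of x1] u(2)[of x2] x1 x2 fit1 fit2 K by (auto simp: payoff_eq)
    qed (use x in auto)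
    then show False
      using strict[OF x] u(3) by simp
  qed
  show "lower_level (contact_set \<mu> \<sigma> r K l) l x1"
    unfolding lower_level_def using x1 x2 mem gap_free by auto
  show "upper_level (contact_set \<mu> \<sigma> r K l) l x2"
    unfolding upper_level_def using x1 x2 mem gap_free by auto
qed

section \<open>The level at an infinite tangency\<close>

text \<open>
  For \<open>w = (f \<circ> F) \<phi>\<close> the quotient \<open>(w' \<phi> - w \<phi>') / wronskian\<close> is \<open>f' \<circ> F\<close>. Its derivative has the
  sign of \<open>q = \<L> w - r w\<close>, so that sign decides convexity in the coordinate \<open>F\<close>.
\<close>

lemma slope_deriv:
  assumes "0 < x" and w: "(w has_real_derivative w' x) (at x)" "(w' has_real_derivative w'') (at x)"
    and q: "1/2 * (\<sigma> x)\<^sup>2 * w'' + \<mu> x * w' x - r * w x = q"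
  shows "((\<lambda>x. (w' x * \<phi> x - w x * \<phi>' x) / wronskian x) has_real_derivative
     2 * q * \<phi> x / ((\<sigma> x)\<^sup>2 * wronskian x)) (at x)"
proof -
  have W: "(wronskian has_real_derivative \<psi>'' x * \<phi> x - \<psi> x * \<phi>'' x) (at x)"
    unfolding wronskian_def[abs_def]
    using DERIV_diff[OF DERIV_mult[OF psi_deriv2 phi_deriv] DERIV_mult[OF psi_deriv phi_deriv2]] assms(1)
    by (simp add: algebra_simps)
  have N: "((\<lambda>x. w' x * \<phi> x - w x * \<phi>' x) has_real_derivative w'' * \<phi> x - w x * \<phi>'' x) (at x)"
    using DERIV_diff[OF DERIV_mult[OF w(2) phi_deriv] DERIV_mult[OF w(1) phi_deriv2]] assms(1)
    by (simp add: algebra_simps)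
  have W_pos: "0 < wronskian x" and s_pos: "0 < (\<sigma> x)\<^sup>2"
    using wronskian_pos sigma_sq_pos assms(1) by auto
  define S where "S = (\<sigma> x)\<^sup>2"
  have w'': "S * w'' = 2 * q + 2 * r * w x - 2 * \<mu> x * w' x"
    and phi'': "S * \<phi>'' x = 2 * r * \<phi> x - 2 * \<mu> x * \<phi>' x"
    and psi'': "S * \<psi>'' x = 2 * r * \<psi> x - 2 * \<mu> x * \<psi>' x"
    using q phi_ode[OF assms(1)] psi_ode[OF assms(1)] unfolding S_def by (auto simp: algebra_simps)
  let ?N = "w' x * \<phi> x - w x * \<phi>' x"
  have N': "S * (w'' * \<phi> x - w x * \<phi>'' x) = 2 * q * \<phi> x - 2 * \<mu> x * ?N"
  proof -
    have "S * (w'' * \<phi> x - w x * \<phi>'' x) = (S * w'') * \<phi> x - w x * (S * \<phi>'' x)"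
      by (simp add: algebra_simps)
    then show ?thesis
      unfolding w'' phi'' by (simp add: algebra_simps)
  qed
  have W': "S * (\<psi>'' x * \<phi> x - \<psi> x * \<phi>'' x) = - 2 * \<mu> x * wronskian x"
  proof -
    have "S * (\<psi>'' x * \<phi> x - \<psi> x * \<phi>'' x) = (S * \<psi>'' x) * \<phi> x - \<psi> x * (S * \<phi>'' x)"
      by (simp add: algebra_simps)
    then show ?thesis
      unfolding phi'' psi'' wronskian_def by (simp add: algebra_simps)
  qed
  have "S * ((w'' * \<phi> x - w x * \<phi>'' x) * wronskian x - ?N * (\<psi>'' x * \<phi> x - \<psi> x * \<phi>'' x))
      = (S * (w'' * \<phi> x - w x * \<phi>'' x)) * wronskian x - ?N * (S * (\<psi>'' x * \<phi> x - \<psi> x * \<phi>'' x))"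
    by (simp add: algebra_simps)
  also have "\<dots> = 2 * q * \<phi> x * wronskian x"
    unfolding N' W' by (simp add: algebra_simps)
  finally have "((w'' * \<phi> x - w x * \<phi>'' x) * wronskian x - ?N * (\<psi>'' x * \<phi> x - \<psi> x * \<phi>'' x))
      = 2 * q * \<phi> x * wronskian x / S"
    using s_pos unfolding S_def by (simp add: field_simps)
  then have "((w'' * \<phi> x - w x * \<phi>'' x) * wronskian x - ?N * (\<psi>'' x * \<phi> x - \<psi> x * \<phi>'' x))
      / (wronskian x * wronskian x) = 2 * q * \<phi> x / ((\<sigma> x)\<^sup>2 * wronskian x)"
    using W_pos unfolding S_def by simp
  then show ?thesis
    using DERIV_divide[OF N W] W_pos by simp
qed

text \<open>
  A slope of at least \<open>\<epsilon>\<close> in the coordinate \<open>F\<close> makes \<open>w/\<phi>\<close> grow at least like \<open>\<epsilon> F\<close>, that is,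
  \<open>w\<close> like \<open>\<epsilon> \<psi>\<close>.
\<close>

lemma slope_bound_of_sublinear:
  assumes "0 < x0" and w: "\<And>x. x0 \<le> x \<Longrightarrow> (w has_real_derivative w' x) (at x)"
    and slope: "\<And>x. x0 \<le> x \<Longrightarrow> \<epsilon> \<le> (w' x * \<phi> x - w x * \<phi>' x) / wronskian x"
    and sublinear: "((\<lambda>x. w x / \<psi> x) \<longlongrightarrow> 0) at_top"
  shows "\<epsilon> \<le> 0"
proof -
  let ?f = "\<lambda>x. w x / \<phi> x - \<epsilon> * F x"
  have mono: "?f x0 \<le> ?f x" if "x0 \<le> x" for x
  proof (rule DERIV_nonneg_imp_nondecreasing[OF that])
    fix y assume y: "x0 \<le> y"
    then have y_pos: "0 < y"
      using assms(1) by simp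
    have "\<epsilon> * wronskian y \<le> w' y * \<phi> y - w y * \<phi>' y"
      using slope[OF y] wronskian_pos[OF y_pos] by (simp add: field_simps)
    then have "0 \<le> (w' y * \<phi> y - w y * \<phi>' y) / (\<phi> y)\<^sup>2 - \<epsilon> * (wronskian y / (\<phi> y)\<^sup>2)"
      using divide_right_mono[of "\<epsilon> * wronskian y" "w' y * \<phi> y - w y * \<phi>' y" "(\<phi> y)\<^sup>2"] by simp
    moreover have "(?f has_real_derivative
        (w' y * \<phi> y - w y * \<phi>' y) / (\<phi> y)\<^sup>2 - \<epsilon> * (wronskian y / (\<phi> y)\<^sup>2)) (at y)"
      by (intro DERIV_diff DERIV_cmult quotient_phi_deriv F_deriv w y y_pos)
    ultimately show "\<exists>d. (?f has_real_derivative d) (at y) \<and> 0 \<le> d"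
      by blast
  qed
  have "\<forall>\<^sub>F x in at_top. ?f x0 / F x + \<epsilon> \<le> w x / \<psi> x"
    using eventually_ge_at_top[of x0]
  proof eventually_elim
    fix x assume x: "x0 \<le> x"
    then have pos: "0 < F x" "0 < \<phi> x" "0 < \<psi> x"
      using assms(1) F_pos phi_pos psi_pos by auto
    have "?f x0 + \<epsilon> * F x \<le> w x / \<phi> x"
      using mono[OF x] by simp
    then have "(?f x0 + \<epsilon> * F x) / F x \<le> w x / \<phi> x / F x"
      using pos(1) by (intro divide_right_mono) auto
    moreover have "w x / \<phi> x / F x = w x / \<psi> x"
      using pos by (simp add: F_fun_def)
    moreover have "(?f x0 + \<epsilon> * F x) / F x = ?f x0 / F x + \<epsilon>"
      using pos(1) by (simp add: add_divide_distrib)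
    ultimately show "?f x0 / F x + \<epsilon> \<le> w x / \<psi> x"
      by metis
  qed
  moreover have "((\<lambda>x. ?f x0 / F x + \<epsilon>) \<longlongrightarrow> 0 + \<epsilon>) at_top"
    by (intro tendsto_add tendsto_const tendsto_divide_0[OF tendsto_const]
        filterlim_at_top_imp_at_infinity F_at_top)
  ultimately show ?thesis
    using tendsto_le[OF _ sublinear] by fastforce
qed

abbreviation excess_slope :: "real \<Rightarrow> real \<Rightarrow> real \<Rightarrow> real \<Rightarrow> real" where
  "excess_slope a b K x \<equiv>
     ((comb' a b x - 1) * \<phi> x - (comb a b x - (x - K)) * \<phi>' x) / wronskian x"

lemma excess_slope_deriv:
  "0 < x \<Longrightarrow> (excess_slope a b K has_real_derivative
     2 * drift_gap K x * \<phi> x / ((\<sigma> x)\<^sup>2 * wronskian x)) (at x)"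
  by (rule slope_deriv[where w = "\<lambda>x. comb a b x - (x - K)" and w' = "\<lambda>x. comb' a b x - 1"])
    (use excess_deriv excess_deriv2 excess_ode in auto)

lemma excess_over_phi_deriv:
  assumes "0 < x"
  shows "((\<lambda>x. (comb a b x - (x - K)) / \<phi> x) has_real_derivative
     excess_slope a b K x * (wronskian x / (\<phi> x)\<^sup>2)) (at x)"
  using quotient_phi_deriv[OF assms excess_deriv[OF assms]] wronskian_pos[OF assms] by simp

lemma F_deriv_pos: "0 < x \<Longrightarrow> 0 < wronskian x / (\<phi> x)\<^sup>2"
  using phi_pos[of x] wronskian_pos[of x] by simp

text \<open>The choice \<open>b = L\<^sub>\<infinity>\<close> matches the growth of \<open>h\<close> to that of the payoff.\<close>

lemma excess_sublinear:
  assumes "0 < K" "K < l"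
  shows "((\<lambda>x. (comb a (L_infinity \<psi> K l) x - (x - K)) / \<psi> x) \<longlongrightarrow> 0) at_top"
  using tendsto_diff[OF comb_over_psi_at_top[of a "L_infinity \<psi> K l"] L_infinity_tendsto[OF assms]]
  by (simp add: diff_divide_distrib)

text \<open>
  Where \<open>\<theta> \<ge> r K\<close> the excess over \<open>\<phi>\<close> is convex in the coordinate \<open>F\<close>; being sublinear in it, it
  cannot have a positive slope.
\<close>

lemma excess_decreasing_tail:
  assumes K: "0 < K" "K < l" and x0: "0 < x0" "0 \<le> drift_gap K x0" and xy: "x0 \<le> x" "x \<le> y"
  defines "b \<equiv> L_infinity \<psi> K l"
  shows "(comb a b y - (y - K)) / \<phi> y \<le> (comb a b x - (x - K)) / \<phi> x"
proof -
  have slope_mono: "excess_slope a b K z \<le> excess_slope a b K z'" if "x0 \<le> z" "z \<le> z'" for z z'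
  proof (rule DERIV_nonneg_imp_nondecreasing[OF that(2)])
    fix p assume "z \<le> p"
    then have p: "0 < p" "0 \<le> drift_gap K p"
      using that x0 drift_gap_mono[of x0 p K] by auto
    have "0 \<le> 2 * drift_gap K p * \<phi> p / ((\<sigma> p)\<^sup>2 * wronskian p)"
      using p phi_pos[OF p(1)] wronskian_pos[OF p(1)] by simp
    then show "\<exists>d. (excess_slope a b K has_real_derivative d) (at p) \<and> 0 \<le> d"
      using excess_slope_deriv[OF p(1)] by blast
  qed
  have slope_neg: "excess_slope a b K z \<le> 0" if "x0 \<le> z" for z
  proof (rule slope_bound_of_sublinear[of z])
    show "((\<lambda>x. comb a b x - (x - K)) has_real_derivative comb' a b p - 1) (at p)" if "z \<le> p" for p
      using that \<open>x0 \<le> z\<close> x0 by (intro excess_deriv) simp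
    show "((\<lambda>x. (comb a b x - (x - K)) / \<psi> x) \<longlongrightarrow> 0) at_top"
      unfolding b_def by (rule excess_sublinear[OF K])
  qed (use that x0 slope_mono in auto)
  show ?thesis
  proof (rule DERIV_nonpos_imp_nonincreasing[OF xy(2)])
    fix p assume "x \<le> p"
    then have p: "0 < p" "x0 \<le> p"
      using xy x0 by auto
    have "excess_slope a b K p * (wronskian p / (\<phi> p)\<^sup>2) \<le> 0"
      using slope_neg[OF p(2)] F_deriv_pos[OF p(1)]
      by (intro mult_nonpos_nonneg) auto
    then show "\<exists>d. ((\<lambda>x. (comb a b x - (x - K)) / \<phi> x) has_real_derivative d) (at p) \<and> d \<le> 0"
      using excess_over_phi_deriv[OF p(1)] by blast
  qed
qed

text \<open>The concave counterpart: a negative slope would persist.\<close>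

lemma excess_increasing_tail:
  assumes K: "0 < K" "K < l" and x0: "0 < x0" "\<And>p. x0 \<le> p \<Longrightarrow> drift_gap K p \<le> 0" and x: "x0 \<le> x"
  defines "b \<equiv> L_infinity \<psi> K l"
  shows "(comb a b x0 - (x0 - K)) / \<phi> x0 \<le> (comb a b x - (x - K)) / \<phi> x"
proof -
  have slope_mono: "excess_slope a b K z' \<le> excess_slope a b K z" if "x0 \<le> z" "z \<le> z'" for z z'
  proof (rule DERIV_nonpos_imp_nonincreasing[OF that(2)])
    fix p assume "z \<le> p"
    then have p: "0 < p" "drift_gap K p \<le> 0"
      using that x0 by auto
    have "2 * drift_gap K p * \<phi> p / ((\<sigma> p)\<^sup>2 * wronskian p) \<le> 0"
      using mult_nonpos_nonneg[OF p(2) less_imp_le[OF phi_pos[OF p(1)]]] wronskian_pos[OF p(1)]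
      by (intro divide_nonpos_nonneg) (auto simp: mult.commute)
    then show "\<exists>d. (excess_slope a b K has_real_derivative d) (at p) \<and> d \<le> 0"
      using excess_slope_deriv[OF p(1)] by blast
  qed
  have slope_pos: "0 \<le> excess_slope a b K z" if "x0 \<le> z" for z
  proof -
    have "- excess_slope a b K z \<le> 0"
    proof (rule slope_bound_of_sublinear[of z])
      show "((\<lambda>x. - (comb a b x - (x - K))) has_real_derivative - (comb' a b p - 1)) (at p)"
        if "z \<le> p" for p
        using that \<open>x0 \<le> z\<close> x0 by (intro DERIV_minus excess_deriv) simp
      show "((\<lambda>x. - (comb a b x - (x - K)) / \<psi> x) \<longlongrightarrow> 0) at_top"
        using tendsto_minus[OF excess_sublinear[OF K, of a]]
        unfolding b_def by (simp only: minus_zero minus_divide_left)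
      show "- excess_slope a b K z
          \<le> (- (comb' a b p - 1) * \<phi> p - - (comb a b p - (p - K)) * \<phi>' p) / wronskian p"
        if "z \<le> p" for p
      proof -
        have "(- (comb' a b p - 1) * \<phi> p - - (comb a b p - (p - K)) * \<phi>' p) / wronskian p
            = - excess_slope a b K p"
          unfolding minus_divide_left by (simp add: algebra_simps)
        moreover have "- excess_slope a b K z \<le> - excess_slope a b K p"
          unfolding neg_le_iff_le by (rule slope_mono[OF \<open>x0 \<le> z\<close> that])
        ultimately show ?thesis
          by metis
      qed
    qed (use that x0 in simp)
    then show ?thesis
      by simp
  qed
  show ?thesis
  proof (rule DERIV_nonneg_imp_nondecreasing[OF x])
    fix p assume p: "x0 \<le> p"
    then have p_pos: "0 < p"
      using x0 by auto
    have "0 \<le> excess_slope a b K p * (wronskian p / (\<phi> p)\<^sup>2)"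
      using slope_pos[OF p] F_deriv_pos[OF p_pos]
      by (intro mult_nonneg_nonneg) auto
    then show "\<exists>d. ((\<lambda>x. (comb a b x - (x - K)) / \<phi> x) has_real_derivative d) (at p) \<and> 0 \<le> d"
      using excess_over_phi_deriv[OF p_pos] by blast
  qed
qed

text \<open>Below \<open>l\<close> the payoff is the constant \<open>s\<close>, for which \<open>\<L> s - r s = -r s < 0\<close>.\<close>

lemma G_slope_strictly_decreasing:
  assumes "K < l" "0 < x" "x < y" "y < l"
  shows "deriv (G K l) (F y) < deriv (G K l) (F x)"
proof -
  let ?P = "\<lambda>x. (0 * \<phi> x - (l - K) * \<phi>' x) / wronskian x"
  have G': "deriv (G K l) (F z) = ?P z" if "0 < z" "z < l" for z
    using DERIV_imp_deriv[OF G_deriv[OF that(1) payoff_deriv_below[OF assms(1) that(2)]]] that assms(1)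
    by (simp add: payoff_eq)
  have "?P y < ?P x"
  proof (rule DERIV_neg_imp_decreasing[OF assms(3)])
    fix p assume "x \<le> p"
    then have p: "0 < p"
      using assms by simp
    have "(?P has_real_derivative 2 * (- r * (l - K)) * \<phi> p / ((\<sigma> p)\<^sup>2 * wronskian p)) (at p)"
      by (rule slope_deriv[where w = "\<lambda>_. l - K" and w' = "\<lambda>_. 0", OF p]) auto
    moreover have "2 * (- r * (l - K)) * \<phi> p / ((\<sigma> p)\<^sup>2 * wronskian p) < 0"
      using r_pos assms(1) phi_pos[OF p] sigma_sq_pos[OF p] wronskian_pos[OF p]
      by (intro divide_neg_pos mult_neg_pos mult_pos_neg) auto
    ultimately show "\<exists>d. (?P has_real_derivative d) (at p) \<and> d < 0"
      by blast
  qed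
  then show ?thesis
    using G' assms by simp
qed

text \<open>
  Uniqueness of the point with slope \<open>L\<^sub>\<infinity>\<close> needs every \<open>z\<close> in \<open>(0, F(l))\<close> to be a value of \<open>F\<close>,
  which is where \<open>\<psi>(0+) = 0\<close> comes in.
\<close>

lemma z_infinity_eq:
  assumes "K < l" "0 < x1" "x1 < l" "deriv (G K l) (F x1) = L_infinity \<psi> K l"
  shows "z_infinity \<psi> \<phi> K l = F x1"
  unfolding z_infinity_def
proof (rule the_equality)
  show "0 < F x1 \<and> F x1 < F l \<and> deriv (G K l) (F x1) = L_infinity \<psi> K l"
    using assms F_pos F_less by simp
next
  fix z assume z: "0 < z \<and> z < F l \<and> deriv (G K l) z = L_infinity \<psi> K l"
  have "0 < l"
    using assms by simp
  then obtain x where x: "0 < x" "x < l" "F x = z"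
    using F_surj_below[of z l] z by blast
  then show "z = F x1"
    using G_slope_strictly_decreasing[OF assms(1), of x x1]
      G_slope_strictly_decreasing[OF assms(1), of x1 x] z assms by (cases x x1 rule: linorder_cases) auto
qed

text \<open>
  If \<open>\<theta> < r K\<close> on \<open>[l, \<infinity>)\<close>, the excess over \<open>\<phi>\<close> is nondecreasing from its positive value at \<open>l\<close>.
  Otherwise it is eventually nonincreasing, so \<open>G - L\<^sub>z = -w/\<phi>\<close> eventually increases to the
  asymptotic gap, which is thus a true limit; as it is at most \<open>0\<close>, the excess \<open>w\<close> is nonnegative
  wherever \<open>\<theta> \<ge> r K\<close>. A negative value before that region would produce a negative interior
  minimum, and such a minimum lies in the region \<open>\<theta> \<ge> r K\<close>.
\<close>

lemma infinite_tangency_excess_nonneg: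
  assumes K: "0 < K" "K < l" and x1: "0 < x1" "x1 < l"
    and tangency: "deriv (G K l) (F x1) = L_infinity \<psi> K l"
    and gap: "asymptotic_gap \<psi> \<phi> K l \<le> 0"
    and fit: "comb a (L_infinity \<psi> K l) x1 = l - K"
    and above_l: "l - K < comb a (L_infinity \<psi> K l) l"
    and x: "l \<le> x"
  shows "x - K \<le> comb a (L_infinity \<psi> K l) x"
proof (rule ccontr)
  define b where "b = L_infinity \<psi> K l"
  let ?e = "\<lambda>x. comb a b x - (x - K)"
  assume "\<not> x - K \<le> comb a (L_infinity \<psi> K l) x"
  then have neg: "?e x < 0"
    by (simp add: b_def)
  have l_pos: "0 < l"
    using K by simp
  define D where "D y = G K l y - tangent_line \<psi> \<phi> K l (z_infinity \<psi> \<phi> K l) y" for y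
  have D_F: "D (F z) = - (?e z / \<phi> z)" if "l \<le> z" for z
  proof -
    have z_pos: "0 < z"
      using that l_pos by simp
    have "(l - K) / \<phi> x1 = a + b * F x1"
      using fit phi_pos[OF x1(1)] unfolding b_def[symmetric] comb_def F_fun_def
      by (simp add: field_simps)
    then have "tangent_line \<psi> \<phi> K l (z_infinity \<psi> \<phi> K l) (F z) = a + b * F z"
      unfolding z_infinity_eq[OF K(2) x1 tangency] tangent_line_def tangency
      using x1 K by (simp add: G_at_F payoff_eq b_def algebra_simps)
    moreover have "a + b * F z = comb a b z / \<phi> z"
      using phi_pos[OF z_pos] by (simp add: comb_def F_fun_def field_simps)
    moreover have "G K l (F z) = (z - K) / \<phi> z"
      using that z_pos K by (simp add: G_at_F payoff_eq)
    ultimately show ?thesis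
      by (simp add: D_def diff_divide_distrib)
  qed
  have tail: "0 \<le> ?e z" if z: "l \<le> z" "0 \<le> drift_gap K z" for z
  proof -
    have z_pos: "0 < z"
      using z l_pos by simp
    have "mono_on {F z..} (\<lambda>y. ereal (D y))"
    proof (rule mono_onI)
      fix y y' assume y: "y \<in> {F z..}" "y' \<in> {F z..}" "y \<le> y'"
      obtain p where p: "z \<le> p" "F p = y"
        by (rule F_surj_above[OF z_pos, of y]) (use y in auto)
      obtain p' where p': "p \<le> p'" "F p' = y'"
        by (rule F_surj_above[of p y']) (use y p z_pos in auto)
      show "ereal (D y) \<le> ereal (D y')"
        using excess_decreasing_tail[OF K z_pos z(2) p(1) p'(1), of a] D_F[of p] D_F[of p'] p p' z
        by (simp add: b_def)
    qed
    then have "((\<lambda>y. ereal (D y)) \<longlongrightarrow> (SUP y\<in>{F z..}. ereal (D y))) at_top"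
      by (rule tendsto_SUP_at_top)
    then have "asymptotic_gap \<psi> \<phi> K l = (SUP y\<in>{F z..}. ereal (D y))"
      unfolding asymptotic_gap_def D_def by (intro tendsto_Lim) auto
    moreover have "ereal (D (F z)) \<le> (SUP y\<in>{F z..}. ereal (D y))"
      by (rule SUP_upper) simp
    ultimately have "ereal (D (F z)) \<le> 0"
      using gap by (metis order_trans)
    then show ?thesis
      using D_F[OF z(1)] phi_pos[OF z_pos] by (simp add: zero_le_divide_iff)
  qed
  show False
  proof (cases "\<exists>z\<ge>l. 0 \<le> drift_gap K z")
    case True
    then obtain z where z: "l \<le> z" "0 \<le> drift_gap K z"
      by blast
    have "x < z"
      using tail[of x] drift_gap_mono[of z x K] z neg x l_pos by (cases "x < z") auto
    obtain m where m: "l \<le> m" "m \<le> z" "\<forall>y. l \<le> y \<and> y \<le> z \<longrightarrow> ?e m \<le> ?e y"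
      by (rule excess_attains_min[OF l_pos z(1), of a b K])
    have m_neg: "?e m < 0"
      using m(3)[rule_format, of x] neg x \<open>x < z\<close> by simp
    have "m \<noteq> l" "m \<noteq> z"
      using m_neg above_l tail[OF z] unfolding b_def[symmetric] by auto
    then have "- r * ?e m \<le> drift_gap K m"
      using m by (intro drift_gap_at_interior_min[OF l_pos, of m z]) auto
    moreover have "0 \<le> - r * ?e m"
      using r_pos m_neg by (simp add: mult_nonneg_nonpos)
    ultimately show False
      using tail[OF m(1)] m_neg by linarith
  next
    case False
    have "?e l / \<phi> l \<le> ?e x / \<phi> x"
      unfolding b_def using False by (intro excess_increasing_tail[OF K l_pos _ x]) force
    moreover have "0 < ?e l / \<phi> l"
      using above_l phi_pos[OF l_pos] by (simp add: b_def)
    ultimately have "0 < ?e x / \<phi> x"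
      by simp
    moreover have "0 < \<phi> x"
      using x l_pos by (intro phi_pos) simp
    ultimately show False
      using neg by (simp add: zero_less_divide_iff)
  qed
qed

text \<open>
  The maximum principle needs \<open>h \<le> u\<close> at a right end point, which nothing provides for \<open>h\<close> itself.
  Lowering \<open>b\<close> by \<open>\<epsilon>\<close> puts the harmonic function below the payoff far out, since both are
  asymptotically \<open>b \<psi>\<close>.
\<close>

lemma comb_le_majorant:
  assumes K: "0 < K" "K < l" and x1: "0 < x1" "x1 < l" and x: "x1 \<le> x"
    and fit: "comb a (L_infinity \<psi> K l) x1 = l - K"
    and u: "supersolution_on \<mu> \<sigma> r {0<..} u" "\<And>y. 0 < y \<Longrightarrow> payoff K l y \<le> u y"
  shows "comb a (L_infinity \<psi> K l) x \<le> u x"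
proof (rule ccontr)
  define b where "b = L_infinity \<psi> K l"
  have x_pos: "0 < x"
    using x x1 by simp
  assume "\<not> comb a (L_infinity \<psi> K l) x \<le> u x"
  then have neg: "u x < comb a b x"
    by (simp add: b_def)
  \<comment> \<open>Lowering \<open>b\<close> by this \<open>\<epsilon>\<close> removes half of the violation at \<open>x\<close>.\<close>
  define \<epsilon> where "\<epsilon> = (comb a b x - u x) / (2 * \<psi> x)"
  have \<epsilon>: "0 < \<epsilon>"
    using neg psi_pos[OF x_pos] by (simp add: \<epsilon>_def)
  have "((\<lambda>y. comb a (b - \<epsilon>) y / \<psi> y - (y - K) / \<psi> y) \<longlongrightarrow> (b - \<epsilon>) - b) at_top"
    unfolding b_def by (intro tendsto_diff comb_over_psi_at_top L_infinity_tendsto K)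
  then have "\<forall>\<^sub>F y in at_top. comb a (b - \<epsilon>) y / \<psi> y - (y - K) / \<psi> y < 0"
    using \<epsilon> by (intro order_tendstoD(2)) auto
  moreover have "\<forall>\<^sub>F y in at_top. max x l \<le> y"
    by (rule eventually_ge_at_top)
  ultimately have "\<forall>\<^sub>F y in at_top. comb a (b - \<epsilon>) y / \<psi> y - (y - K) / \<psi> y < 0 \<and> max x l \<le> y"
    by eventually_elim simp
  then obtain N where N: "comb a (b - \<epsilon>) N / \<psi> N - (N - K) / \<psi> N < 0" "max x l \<le> N"
    using eventually_happens[of _ "at_top :: real filter"] trivial_limit_at_top_linorder by blast
  have N_pos: "0 < N"
    using N(2) x_pos by simp
  have "comb a (b - \<epsilon>) x \<le> u x"
  proof (rule comb_le_supersolution[OF x1(1)])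
    show "supersolution_on \<mu> \<sigma> r {x1..N} u"
      using u(1) by (rule supersolution_on_subset) (use x1 in auto)
    have "comb a (b - \<epsilon>) x1 \<le> comb a b x1"
      using \<epsilon> psi_pos[OF x1(1)] by (simp add: comb_def mult_right_mono)
    then show "comb a (b - \<epsilon>) x1 \<le> u x1"
      using u(2)[OF x1(1)] fit x1 K by (simp add: b_def payoff_eq)
    have "comb a (b - \<epsilon>) N \<le> N - K"
      using N(1) psi_pos[OF N_pos] by (simp add: divide_less_cancel)
    then show "comb a (b - \<epsilon>) N \<le> u N"
      using u(2)[OF N_pos] N(2) K by (simp add: payoff_eq)
  qed (use x N in auto)
  moreover have "comb a (b - \<epsilon>) x = comb a b x - \<epsilon> * \<psi> x"
    by (simp add: comb_def algebra_simps)
  moreover have "\<epsilon> * \<psi> x = (comb a b x - u x) / 2"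
    using psi_pos[OF x_pos] by (simp add: \<epsilon>_def)
  ultimately show False
    using neg by (simp add: field_simps)
qed

lemma infinite_tangency_level:
  assumes K: "0 < K" "K < l" and x1: "0 < x1" "x1 < l"
    and tangency: "deriv (\<lambda>x. payoff K l x / \<phi> x) x1 = L_infinity \<psi> K l * deriv F x1"
    and gap: "asymptotic_gap \<psi> \<phi> K l \<le> 0"
  shows "lower_level (contact_set \<mu> \<sigma> r K l) l x1"
proof -
  define b where "b = L_infinity \<psi> K l"
  define a where "a = (l - K - b * \<psi> x1) / \<phi> x1"
  note g' = payoff_deriv_below[OF K(2) x1(2)]
  have g1: "payoff K l x1 = l - K"
    using x1 K by (simp add: payoff_eq)
  have fit: "comb a b x1 = l - K"
    using phi_pos[OF x1(1)] by (simp add: a_def comb_def)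
  have "(0 * \<phi> x1 - payoff K l x1 * \<phi>' x1) / (\<phi> x1)\<^sup>2 = b * (wronskian x1 / (\<phi> x1)\<^sup>2)"
    using tangency
    unfolding DERIV_imp_deriv[OF quotient_phi_deriv[OF x1(1) g']] DERIV_imp_deriv[OF F_deriv[OF x1(1)]]
      b_def .
  then have "0 * \<phi> x1 - payoff K l x1 * \<phi>' x1 = b * wronskian x1"
    using phi_pos[OF x1(1)] by (simp add: field_simps)
  then have slope: "deriv (G K l) (F x1) = b"
    using DERIV_imp_deriv[OF G_deriv[OF x1(1) g']] wronskian_pos[OF x1(1)] by simp
  have fit': "comb' a b x1 = 0"
    by (rule smooth_fit[OF x1(1) g' _ slope]) (simp add: fit g1)
  have above_s: "l - K < comb a b x" if "x1 < x" for x
    by (rule comb_above_start[OF x1(1) that fit fit']) (use K in simp)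
  have above_lin: "x - K \<le> comb a b x" if "l \<le> x" for x
    using infinite_tangency_excess_nonneg[OF K x1 _ gap _ _ that, of a] slope fit above_s[OF x1(2)]
    unfolding b_def by blast
  define v where "v x = (if x < x1 then l - K else comb a b x)" for x
  have "(comb a b has_real_derivative 0) (at x1)"
    using comb_deriv[OF x1(1), of a b] fit' by simp
  then have "supersolution_on \<mu> \<sigma> r {0<..} v"
    unfolding v_def
    by (intro supersolution_on_glue[OF const_supersolution comb_supersolution]) (use K x1 fit in auto)
  moreover have "payoff K l x \<le> v x" for x
  proof -
    consider "x < x1" | "x = x1" | "x1 < x" "x < l" | "l \<le> x"
      by linarith
    then show ?thesis
      using above_s[of x] above_lin[of x] x1 fit K by cases (auto simp: v_def payoff_eq)
  qed
  moreover have "v x1 = payoff K l x1"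
    by (simp add: v_def fit g1)
  ultimately have "x1 \<in> contact_set \<mu> \<sigma> r K l"
    using x1 unfolding contact_set_def by blast
  moreover have "x \<notin> contact_set \<mu> \<sigma> r K l" if x: "x1 < x" "x \<le> l" for x
  proof
    assume "x \<in> contact_set \<mu> \<sigma> r K l"
    then obtain u where u: "supersolution_on \<mu> \<sigma> r {0<..} u" "\<And>y. 0 < y \<Longrightarrow> payoff K l y \<le> u y"
      "u x = payoff K l x"
      unfolding contact_set_def by blast
    have "comb a b x \<le> u x"
      unfolding b_def
      by (rule comb_le_majorant[OF K x1 less_imp_le[OF x(1)] _ u(1,2)]) (use fit in \<open>simp_all add: b_def\<close>)
    then show False
      using above_s[OF x(1)] u(3) x K by (simp add: payoff_eq)
  qed
  ultimately show ?thesis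
    using x1 unfolding lower_level_def by auto
qed

lemma critical_x1_lower_level:
  assumes "0 < K" "K < l" "critical_x1 \<psi> \<phi> K l x1"
  shows "lower_level (contact_set \<mu> \<sigma> r K l) l x1"
  using assms(3) unfolding critical_x1_def case_A3_def
  by (elim disjE conjE exE)
     (blast intro: double_tangency_levels[OF assms(1,2)] infinite_tangency_level[OF assms(1,2)])+

lemma critical_x2_upper_level:
  assumes "0 < K" "K < l" "critical_x2 \<psi> \<phi> K l x2"
  shows "upper_level (contact_set \<mu> \<sigma> r K l) l x2"
  using assms(3) double_tangency_levels(2)[OF assms(1,2)] unfolding critical_x2_def by blast

end

section \<open>Monotonicity of the critical levels\<close>

theorem proposition3p4:
  fixes M :: "'a measure" and \<F> :: "ennreal \<Rightarrow> 'a measure"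
    and B :: "real \<Rightarrow> 'a \<Rightarrow> real" and \<mu> \<sigma> :: "real \<Rightarrow> real"
    and X :: "real \<Rightarrow> real \<Rightarrow> 'a \<Rightarrow> real"
    and R :: "real set" and \<psi> \<phi> :: "real \<Rightarrow> real \<Rightarrow> real"
    and x1_is x2_is :: "real \<Rightarrow> real \<Rightarrow> real \<Rightarrow> real \<Rightarrow> bool"
  assumes diffusion: "diffusion_setting M \<F> B \<mu> \<sigma> X"
    and parameters: "\<And>r. r \<in> R \<Longrightarrow> discount_setting M \<mu> \<sigma> X r (\<psi> r) (\<phi> r)"
    and levels:
      "(x1_is, x2_is) = (\<lambda>r K l. critical_x1 (\<psi> r) (\<phi> r) K l, \<lambda>r K l. critical_x2 (\<psi> r) (\<phi> r) K l) \<or>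
       (x1_is, x2_is) = (\<lambda>r K l. region_x1 M \<F> X r K l, \<lambda>r K l. region_x2 M \<F> X r K l)"
  shows
    "(\<forall>r\<in>R. \<forall>r'\<in>R. \<forall>K l. 0 < K \<and> K < l \<and> r \<le> r' \<longrightarrow>
        (\<forall>x1 x1'. x1_is r K l x1 \<and> x1_is r' K l x1' \<longrightarrow> x1 \<le> x1') \<and>
        (\<forall>x2 x2'. x2_is r K l x2 \<and> x2_is r' K l x2' \<longrightarrow> x2' \<le> x2)) \<and>
     (\<forall>r\<in>R. \<forall>K K' l. 0 < K \<and> K \<le> K' \<and> K' < l \<longrightarrow>
        (\<forall>x1 x1'. x1_is r K l x1 \<and> x1_is r K' l x1' \<longrightarrow> x1' \<le> x1) \<and>
        (\<forall>x2 x2'. x2_is r K l x2 \<and> x2_is r K' l x2' \<longrightarrow> x2 \<le> x2')) \<and>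
     (\<forall>r\<in>R. \<forall>K l l'. 0 < K \<and> K < l \<and> l \<le> l' \<longrightarrow>
        (\<forall>x1 x1'. x1_is r K l x1 \<and> x1_is r K l' x1' \<longrightarrow> x1 \<le> x1') \<and>
        (\<forall>x2 x2'. x2_is r K l x2 \<and> x2_is r K l' x2' \<longrightarrow> x2 \<le> x2'))"
proof -
  interpret diffusion_setting M \<F> B \<mu> \<sigma> X
    by (rule diffusion)
  have r_nonneg: "0 \<le> r" if "r \<in> R" for r
    using discount_setting.r_pos[OF parameters[OF that]] by simp
  have problem: "discount_problem M \<mu> \<sigma> X r (\<psi> r) (\<phi> r)" if "r \<in> R" for r
    using prob_space_axioms parameters[OF that] sigma_pos natural_boundary
    by (intro discount_problem.intro discount_problem_axioms.intro)
  from levels show ?thesis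
  proof (elim disjE)
    assume "(x1_is, x2_is) =
      (\<lambda>r K l. critical_x1 (\<psi> r) (\<phi> r) K l, \<lambda>r K l. critical_x2 (\<psi> r) (\<phi> r) K l)"
    then have eqs: "x1_is = (\<lambda>r K l. critical_x1 (\<psi> r) (\<phi> r) K l)"
      "x2_is = (\<lambda>r K l. critical_x2 (\<psi> r) (\<phi> r) K l)"
      by auto
    show ?thesis
      unfolding eqs
    proof (rule levels_monotone[where S = "contact_set \<mu> \<sigma>"])
      show "lower_level (contact_set \<mu> \<sigma> r K l) l x"
        if "r \<in> R" "0 < K" "K < l" "critical_x1 (\<psi> r) (\<phi> r) K l x" for r K l x
        by (rule discount_problem.critical_x1_lower_level[OF problem[OF that(1)] that(2-4)])
      show "upper_level (contact_set \<mu> \<sigma> r K l) l x"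
        if "r \<in> R" "0 < K" "K < l" "critical_x2 (\<psi> r) (\<phi> r) K l x" for r K l x
        by (rule discount_problem.critical_x2_upper_level[OF problem[OF that(1)] that(2-4)])
      show "contact_set \<mu> \<sigma> r K l \<subseteq> contact_set \<mu> \<sigma> r' K l" if "r \<le> r'" for r r' K l
        by (rule contact_set_mono_discount[OF that])
      show "x \<in> contact_set \<mu> \<sigma> r K' l'"
        if "r \<in> R" "x \<in> contact_set \<mu> \<sigma> r K l" "0 \<le> \<delta>"
          "\<And>y. payoff K' l' y \<le> payoff K l y + \<delta>" "payoff K' l' x = payoff K l x + \<delta>"
        for r K l K' l' \<delta> x
        by (rule contact_set_transfer[OF r_nonneg[OF that(1)] that(2-5)])
    qed
  next
    assume "(x1_is, x2_is) = (\<lambda>r K l. region_x1 M \<F> X r K l, \<lambda>r K l. region_x2 M \<F> X r K l)"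
    then have eqs: "x1_is = (\<lambda>r K l. region_x1 M \<F> X r K l)"
      "x2_is = (\<lambda>r K l. region_x2 M \<F> X r K l)"
      by auto
    show ?thesis
      unfolding eqs
    proof (rule levels_monotone[where S = "stopping_region M \<F> X"])
      show "lower_level (stopping_region M \<F> X r K l) l x" if "region_x1 M \<F> X r K l x" for r K l x
        by (rule region_x1_lower_level[OF that])
      show "upper_level (stopping_region M \<F> X r K l) l x" if "region_x2 M \<F> X r K l x" for r K l x
        by (rule region_x2_upper_level[OF that])
      show "stopping_region M \<F> X r K l \<subseteq> stopping_region M \<F> X r' K l" if "r \<le> r'" for r r' K l
        by (rule stopping_region_mono_discount[OF that])
      show "x \<in> stopping_region M \<F> X r K' l'"
        if "r \<in> R" "x \<in> stopping_region M \<F> X r K l" "0 \<le> \<delta>"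
          "\<And>y. payoff K' l' y \<le> payoff K l y + \<delta>" "payoff K' l' x = payoff K l x + \<delta>"
        for r K l K' l' \<delta> x
        by (rule stopping_region_transfer[OF r_nonneg[OF that(1)] that(2-5)])
    qed
  qed
qed

end
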